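(* Consider the signalized double-ring system described in the context, with short cycle length $T$, green ratio $\pi$, average network density $k$ and retaining ratio $\xi\in(0,1)$, and let $P$ be its Poincaré map $k_1(t+T)=Pk_1(t)$. In the combinations of regions $(i,j)$ that can possibly have stationary states, the Poincaré maps and the corresponding fixed points $k_1^*$ (satisfying $k_1^*=Pk_1^*$) are as follows. Case $0.5<\xi<1$: - $(1,5)$: $Pk_1(t)=2k(1-e^{-\gamma_1\pi T})+k_1(t)e^{-2\gamma_1\pi T}$; $k_1^*=\frac{2k}{1+e^{-\gamma_1\pi T}}$. - $(1,7)$: $Pk_1(t)=(k_j-2k)(e^{\gamma_5\pi T}-1)+k_1(t)e^{(\gamma_5-\gamma_1)\pi T}$; $k_1^*=\frac{(k_j-2k)(e^{\gamma_5\pi T}-1)}{1-e^{(\gamma_5-\gamma_1)\pi T}}$. - $(2,6)$: $Pk_1(t)=k_1(t)$; $k_1^*=k_1(t)$ (every state is a fixed point). - $(4,7)$: $Pk_1(t)=(k_j-2k)(e^{(\gamma_5-\gamma_3)\pi T}-1)+k_1(t)e^{(\gamma_5-\gamma_3)\pi T}$; $k_1^*=2k-k_j$. - $(3,5)$: $Pk_1(t)=k_j(1-e^{\gamma_2\pi T})e^{-\gamma_4\pi T}+2k(1-e^{-\gamma_4\pi T})+k_1(t)e^{(\gamma_2-\gamma_4)\pi T}$; $k_1^*=\frac{2k(1-e^{-\gamma_4\pi T})-k_j(e^{\gamma_2\pi T}-1)e^{-\gamma_4\pi T}}{1-e^{(\gamma_2-\gamma_4)\pi T}}$. - $(3,7)$: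 $Pk_1(t)=k_j(2e^{\gamma_2\pi T}-e^{2\gamma_2\pi T}-1)-2k(e^{\gamma_2\pi T}-1)+k_1(t)e^{2\gamma_2\pi T}$; $k_1^*=\frac{2k+k_j(e^{\gamma_2\pi T}-1)}{e^{\gamma_2\pi T}+1}$. - $(3,8)$: $Pk_1(t)=k_j(1-e^{(\gamma_2-\gamma_3)\pi T})+k_1(t)e^{(\gamma_2-\gamma_3)\pi T}$; $k_1^*=k_j$. Case $0<\xi<0.5$: - $(1,5)$: $Pk_1(t)=2k(1-e^{-\gamma_1\pi T})+k_1(t)e^{-2\gamma_1\pi T}$; $k_1^*=\frac{2k}{1+e^{-\gamma_1\pi T}}$. - $(2,6)$: $Pk_1(t)=k_1(t)$; $k_1^*=k_1(t)$ (every state is a fixed point). - $(4,7)$: $Pk_1(t)=(k_j-2k)(e^{(\gamma_5-\gamma_3)\pi T}-1)+k_1(t)e^{(\gamma_5-\gamma_3)\pi T}$; $k_1^*=2k-k_j$. - $(4,8)$: $Pk_1(t)=k_j(e^{-2\gamma_3\pi T}-2e^{-\gamma_3\pi T}+1)-2k(e^{-2\gamma_3\pi T}-e^{-\gamma_3\pi T})+k_1(t)e^{-2\gamma_3\pi T}$; $k_1^*=\frac{k_j(1-e^{-\gamma_3\pi T})+2ke^{-\gamma_3\pi T}}{1+e^{-\gamma_3\pi T}}$. - $(3,8)$: $Pk_1(t)=k_j(1-e^{(\gamma_2-\gamma_3)\pi T})+k_1(t)e^{(\gamma_2-\gamma_3)\pi T}$; $k_1^*=k_j$. Case $\xi=0.5$: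 - $(1,5)$: $Pk_1(t)=2k(1-e^{-\gamma_1\pi T})+k_1(t)e^{-2\gamma_1\pi T}$; $k_1^*=\frac{2k}{1+e^{-\gamma_1\pi T}}$. - $(2,6)$, $(4,7)$, $(3,8)$: $Pk_1(t)=k_1(t)$; $k_1^*=k_1(t)$ (every state is a fixed point).
   Context: Parameters: ring length $L>0$, free-flow speed $v_f>0$, critical density $k_c$ and jam density $k_j$ with $0<k_c<k_j$, retaining ratio $\xi\in(0,1)$ (same for both rings, constant in time), cycle length $T>0$, lost time $\Delta\ge 0$ per phase, green ratio $\pi>0$ (same for both phases; not the circle constant) with $2\pi T=T-2\Delta$. Two rings with densities $k_1(t),k_2(t)\in[0,k_j]$ form a closed network: $k_1(t)+k_2(t)=2k$, with the average network density $k$ constant. Put $$\gamma_1=\gamma_4=\frac{(1-\xi)v_f}{L},\qquad \gamma_2=\gamma_5=\frac{(1-\xi)v_fk_c}{L\xi(k_j-k_c)},\qquad \gamma_3=\frac{v_fk_c}{L(k_j-k_c)}.$$ Dynamics. In each cycle $[nT,(n+1)T)$, $n\in\{0,1,2,\dots\}$: phase one (green for ring 1) is $[nT,nT+\pi T)$; $k_1$ is constant on $[nT+\pi T,nT+\pi T+\Delta)$; phase two (green for ring 2) is $[nT+\pi T+\Delta,(n+1)T-\Delta)$; $k_1$ is constant on $[(n+1)T-\Delta,(n+1)T)$. With the triangular fundamental diagram $Q(x)=\min\{v_fx,\frac{v_fk_c}{k_j-k_c}(k_j-x)\}$, demand $D_a=Q(\min\{k_a,k_c\})$ and supply $S_a=Q(\max\{k_a,k_c\})$,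 $a=1,2$, $k_1$ obeys in phase one $\frac{dk_1}{dt}=-\frac{1-\xi}{L}\min\{D_1,\frac{S_1}{\xi},\frac{S_2}{1-\xi}\}$ and in phase two $\frac{dk_1}{dt}=\frac{1-\xi}{L}\min\{D_2,\frac{S_2}{\xi},\frac{S_1}{1-\xi}\}$. This is written as $\frac{dk_1}{dt}=A_ik_1+B_i$ when $(k_1,k)$ is in region $i$, with the following regions of the $(k_1,k)$ plane. Phase one: - Region 1: $A=-\gamma_1$, $B=0$; $0<k_1<k_c$, $\frac{k_1}{2}\le k\le\frac{k_j}{2}-\frac{((1-\xi)k_j-(2-\xi)k_c)k_1}{2k_c}$. - Region 2: $A=0$, $B=-\gamma_1k_c$; $k_c\le k_1<k_j-\xi(k_j-k_c)$, $\frac{k_1}{2}\le k\le\frac{\xi k_j+(1-\xi)k_c+k_1}{2}$. - Region 3: $A=\gamma_2$, $B=-\gamma_2k_j$; $k_j-\xi(k_j-k_c)\le k_1\le k_j$, $\frac{k_1}{2}\le k\le\frac{2\xi-1}{2\xi}k_j+\frac{k_1}{2\xi}$. - Region 4: $A=-\gamma_3$, $B=-\gamma_3(k_j-2k)$; $0<k_1<k_j$, $\max\{\frac{k_j}{2}-\frac{((1-\xi)k_j-(2-\xi)k_c)k_1}{2k_c},\frac{\xi k_j+(1-\xi)k_c+k_1}{2},\frac{2\xi-1}{2\xi}k_j+\frac{k_1}{2\xi}\}<k\le\frac{k_j+k_1}{2}$. Phase two: - Region 5: $A=-\gamma_4$, $B=2k\gamma_4$; $0\le k_1\le k_j$, $\frac{k_1}{2}\le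 k\le\min\{\frac{k_1+k_c}{2},\frac{k_1}{2}+\frac{k_c(k_j-k_1)}{2(1-\xi)(k_j-k_c)}\}$. - Region 6: $A=0$, $B=\gamma_4k_c$; $0\le k_1\le k_j-(1-\xi)(k_j-k_c)$, $\frac{k_1+k_c}{2}<k\le\frac{k_j+k_1-\xi(k_j-k_c)}{2}$. - Region 7: $A=\gamma_5$, $B=\gamma_5(k_j-2k)$; $0\le k_1\le k_j$, $\max\{\frac{k_j+k_1-\xi(k_j-k_c)}{2},\frac{(1-2\xi)k_j+k_1}{2(1-\xi)}\}<k\le\frac{k_1+k_j}{2}$. - Region 8: $A=-\gamma_3$, $B=\gamma_3k_j$; $k_j-(1-\xi)(k_j-k_c)<k_1\le k_j$, $\frac{k_1}{2}+\frac{k_c(k_j-k_1)}{2(1-\xi)(k_j-k_c)}<k<\frac{(1-2\xi)k_j+k_1}{2(1-\xi)}$. Short cycle lengths: $T$ is short enough that the density evolution orbit does not cross multiple regions during each effective green period, i.e. within a cycle it stays in a single region $i\in\{1,2,3,4\}$ during phase one and in a single region $j\in\{5,6,7,8\}$ during phase two; it is then said to be in the combination of regions $(i,j)$. The Poincaré map is $P:k_1(t)\mapsto k_1(t+T)$, where $t=nT$ is the beginning of a cycle; its formula in the combination $(i,j)$ is obtained by composing the affine flow of region $i$ over time $\pi T$ with that of region $j$ over time $\pi T$. A stationary state is a fixed point $k_1^*=Pk_1^*$.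
   Formalization: The k1* formulas of (1,7) and (3,5) are claimed only if γ5≠γ1, γ2≠γ4 (else zero denominator); unlisted combinations are excluded except (3,5) at k1=k_j, k=k_j/2 for ξ≤0.5, and (1,7), (3,5) for ξ=0.5, k_j=3k_c, k=k_j/2, where stationary states do occur. *)

theory Defs
  imports "HOL-Analysis.Analysis"
begin

record road =
  len :: real  \<comment> \<open>ring length \<open>L\<close>\<close>
  vf :: real   \<comment> \<open>free-flow speed\<close>
  kc :: real   \<comment> \<open>critical density\<close>
  kj :: real   \<comment> \<open>jam density\<close>
  xi :: real   \<comment> \<open>retaining ratio\<close>

record signal =
  cyc :: real    \<comment> \<open>cycle length \<open>T\<close>\<close>
  lost :: real   \<comment> \<open>lost time per phase\<close>
  green :: real  \<comment> \<open>green ratio (the paper's \<open>\<pi>\<close>)\<close>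

definition valid_road :: "road \<Rightarrow> bool" where
  "valid_road R \<longleftrightarrow>
     0 < len R \<and> 0 < vf R \<and> 0 < kc R \<and> kc R < kj R \<and> 0 < xi R \<and> xi R < 1"

definition valid_signal :: "signal \<Rightarrow> bool" where
  "valid_signal S \<longleftrightarrow>
     0 < cyc S \<and> 0 \<le> lost S \<and> 0 < green S \<and> 2 * green S * cyc S = cyc S - 2 * lost S"

definition green_time :: "signal \<Rightarrow> real" where
  "green_time S = green S * cyc S"

definition gamma1 :: "road \<Rightarrow> real" where
  "gamma1 R = (1 - xi R) * vf R / len R"

definition gamma2 :: "road \<Rightarrow> real" where
  "gamma2 R = (1 - xi R) * vf R * kc R / (len R * xi R * (kj R - kc R))"

definition gamma3 :: "road \<Rightarrow> real" where
  "gamma3 R = vf R * kc R / (len R * (kj R - kc R))"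

definition gamma4 :: "road \<Rightarrow> real" where
  "gamma4 R = gamma1 R"

definition gamma5 :: "road \<Rightarrow> real" where
  "gamma5 R = gamma2 R"

definition flow :: "road \<Rightarrow> real \<Rightarrow> real" where
  "flow R x = min (vf R * x) (vf R * kc R / (kj R - kc R) * (kj R - x))"

definition ring_demand :: "road \<Rightarrow> real \<Rightarrow> real" where
  "ring_demand R x = flow R (min x (kc R))"

definition ring_supply :: "road \<Rightarrow> real \<Rightarrow> real" where
  "ring_supply R x = flow R (max x (kc R))"

text \<open>Right-hand sides of the equation for the density of ring 1. The density of ring 2 is
  \<open>2 * k - k1\<close> throughout, \<open>k\<close> being the average network density.\<close>

definition rate_one :: "road \<Rightarrow> real \<Rightarrow> real \<Rightarrow> real" where
  "rate_one R k k1 = - ((1 - xi R) / len R) *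
     min (ring_demand R k1)
       (min (ring_supply R k1 / xi R) (ring_supply R (2 * k - k1) / (1 - xi R)))"

definition rate_two :: "road \<Rightarrow> real \<Rightarrow> real \<Rightarrow> real" where
  "rate_two R k k1 = (1 - xi R) / len R *
     min (ring_demand R (2 * k - k1))
       (min (ring_supply R (2 * k - k1) / xi R) (ring_supply R k1 / (1 - xi R)))"

definition phase_one :: "signal \<Rightarrow> nat \<Rightarrow> real set" where
  "phase_one S n = {real n * cyc S ..< real n * cyc S + green_time S}"

definition lost_one :: "signal \<Rightarrow> nat \<Rightarrow> real set" where
  "lost_one S n = {real n * cyc S + green_time S ..< real n * cyc S + green_time S + lost S}"

definition phase_two :: "signal \<Rightarrow> nat \<Rightarrow> real set" where
  "phase_two S n =
     {real n * cyc S + green_time S + lost S ..< (real n + 1) * cyc S - lost S}"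

definition lost_two :: "signal \<Rightarrow> nat \<Rightarrow> real set" where
  "lost_two S n = {(real n + 1) * cyc S - lost S ..< (real n + 1) * cyc S}"

text \<open>\<open>u\<close> is the density of ring 1 as a function of time, on \<open>{0..}\<close>. At the first instant of a
  green phase the derivative is the right-hand one.\<close>

definition orbit :: "road \<Rightarrow> signal \<Rightarrow> real \<Rightarrow> (real \<Rightarrow> real) \<Rightarrow> bool" where
  "orbit R S k u \<longleftrightarrow>
     continuous_on {0..} u \<and>
     (\<forall>t\<ge>0. u t \<in> {0..kj R} \<and> 2 * k - u t \<in> {0..kj R}) \<and>
     (\<forall>n.
        (\<forall>t\<in>phase_one S n.
           (u has_real_derivative rate_one R k (u t)) (at t within phase_one S n)) \<and>
        (\<forall>t\<in>lost_one S n. u t = u (real n * cyc S + green_time S)) \<and>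
        (\<forall>t\<in>phase_two S n.
           (u has_real_derivative rate_two R k (u t)) (at t within phase_two S n)) \<and>
        (\<forall>t\<in>lost_two S n. u t = u ((real n + 1) * cyc S - lost S)))"

definition poincare :: "road \<Rightarrow> signal \<Rightarrow> real \<Rightarrow> real \<Rightarrow> real" where
  "poincare R S k x =
     (THE y. \<exists>u n. orbit R S k u \<and> u (real n * cyc S) = x \<and> u ((real n + 1) * cyc S) = y)"

text \<open>The regions of the \<open>(k1, k)\<close> plane: 1 to 4 for phase one, 5 to 8 for phase two.\<close>

definition region :: "road \<Rightarrow> nat \<Rightarrow> (real \<times> real) set" where
  "region R i = {(k1, k).
     if i = 1 then
       0 < k1 \<and> k1 < kc R \<and> k1 / 2 \<le> k \<and>
       k \<le> kj R / 2 - ((1 - xi R) * kj R - (2 - xi R) * kc R) * k1 / (2 * kc R)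
     else if i = 2 then
       kc R \<le> k1 \<and> k1 < kj R - xi R * (kj R - kc R) \<and> k1 / 2 \<le> k \<and>
       k \<le> (xi R * kj R + (1 - xi R) * kc R + k1) / 2
     else if i = 3 then
       kj R - xi R * (kj R - kc R) \<le> k1 \<and> k1 \<le> kj R \<and> k1 / 2 \<le> k \<and>
       k \<le> (2 * xi R - 1) / (2 * xi R) * kj R + k1 / (2 * xi R)
     else if i = 4 then
       0 < k1 \<and> k1 < kj R \<and>
       max (kj R / 2 - ((1 - xi R) * kj R - (2 - xi R) * kc R) * k1 / (2 * kc R))
         (max ((xi R * kj R + (1 - xi R) * kc R + k1) / 2)
              ((2 * xi R - 1) / (2 * xi R) * kj R + k1 / (2 * xi R))) < k \<and>
       k \<le> (kj R + k1) / 2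
     else if i = 5 then
       0 \<le> k1 \<and> k1 \<le> kj R \<and> k1 / 2 \<le> k \<and>
       k \<le> min ((k1 + kc R) / 2)
             (k1 / 2 + kc R * (kj R - k1) / (2 * (1 - xi R) * (kj R - kc R)))
     else if i = 6 then
       0 \<le> k1 \<and> k1 \<le> kj R - (1 - xi R) * (kj R - kc R) \<and> (k1 + kc R) / 2 < k \<and>
       k \<le> (kj R + k1 - xi R * (kj R - kc R)) / 2
     else if i = 7 then
       0 \<le> k1 \<and> k1 \<le> kj R \<and>
       max ((kj R + k1 - xi R * (kj R - kc R)) / 2)
           (((1 - 2 * xi R) * kj R + k1) / (2 * (1 - xi R))) < k \<and>
       k \<le> (k1 + kj R) / 2
     else if i = 8 then
       kj R - (1 - xi R) * (kj R - kc R) < k1 \<and> k1 \<le> kj R \<and>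
       k1 / 2 + kc R * (kj R - k1) / (2 * (1 - xi R) * (kj R - kc R)) < k \<and>
       k < ((1 - 2 * xi R) * kj R + k1) / (2 * (1 - xi R))
     else False}"

text \<open>The states at the beginning of a cycle from which, during that cycle, the orbit stays in
  region \<open>i\<close> throughout phase one and in region \<open>j\<close> throughout phase two. Membership expresses
  that the cycle length is short for the orbit in question.\<close>

definition combination :: "road \<Rightarrow> signal \<Rightarrow> real \<Rightarrow> nat \<Rightarrow> nat \<Rightarrow> real set" where
  "combination R S k i j = {x. i \<in> {1, 2, 3, 4} \<and> j \<in> {5, 6, 7, 8} \<and>
     (\<exists>u n. orbit R S k u \<and> u (real n * cyc S) = x \<and>
        (\<forall>t\<in>phase_one S n. (u t, k) \<in> region R i) \<and>
        (\<forall>t\<in>phase_two S n. (u t, k) \<in> region R j))}"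

definition stationary :: "road \<Rightarrow> signal \<Rightarrow> real \<Rightarrow> nat \<Rightarrow> nat \<Rightarrow> real set" where
  "stationary R S k i j = {x \<in> combination R S k i j. poincare R S k x = x}"

definition can_have_stationary :: "road \<Rightarrow> nat \<Rightarrow> nat \<Rightarrow> bool" where
  "can_have_stationary R i j \<longleftrightarrow>
     (\<exists>S k. valid_signal S \<and> stationary R S k i j \<noteq> {})"

definition has_map :: "road \<Rightarrow> signal \<Rightarrow> real \<Rightarrow> nat \<Rightarrow> nat \<Rightarrow> (real \<Rightarrow> real) \<Rightarrow> bool" where
  "has_map R S k i j F \<longleftrightarrow> (\<forall>x\<in>combination R S k i j. poincare R S k x = F x)"

text \<open>The fixed points of the Poincare map in a combination are exactly those of its states that
  lie in \<open>X\<close>, and \<open>X\<close> is the set of all real fixed points of the formula \<open>F\<close>.\<close>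

definition has_fixed_points ::
  "road \<Rightarrow> signal \<Rightarrow> real \<Rightarrow> nat \<Rightarrow> nat \<Rightarrow> (real \<Rightarrow> real) \<Rightarrow> real set \<Rightarrow> bool" where
  "has_fixed_points R S k i j F X \<longleftrightarrow>
     stationary R S k i j = combination R S k i j \<inter> X \<and> (\<forall>x. F x = x \<longleftrightarrow> x \<in> X)"

end

theory Submission
  imports Defs
begin

text \<open>Within one region the density of ring 1 obeys an affine equation, so a green phase spent in
region \<open>i\<close> moves it by an affine map (\<open>region_flow\<close>), and the Poincare map of a combination
\<open>(i, j)\<close> is the composition of two such maps. Its fixed points solve one linear equation. The
equation degenerates exactly when the exponential factors of the two phases cancel, as they
trivially do for \<open>(2, 6)\<close>; for \<open>(4, 7)\<close> and \<open>(3, 8)\<close> this is the case \<open>xi R = 1 / 2\<close>, in which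
\<open>gamma2 R = gamma3 R\<close>. That the
Poincare map is a function of the density alone rests on uniqueness: the rates are minima of
truncated linear functions, hence Lipschitz, also across the boundaries between regions
(\<open>poincare_orbit\<close>, \<open>combinationD\<close>).

Which combinations admit stationary states is decided by a balance of rates. In a stationary
state ring 1 loses in phase one what it regains in phase two, and both phases last equally long.
Phase one run backwards and phase two run forwards then climb over the same interval of densities
in the same time, so by Rolle's theorem there is a density at which the outflow rate of region
\<open>i\<close> equals the inflow rate of region \<open>j\<close> (\<open>balance_point\<close>). This density lies in both regions, and
unless the orbit is constant it lies inside an interval of such densities. A region says which of
a demand and two supplies is the smallest, so for most pairs equality of the two rates
contradicts membership. The few coincidences on a boundary, such as equal lines for
\<open>kj R = 3 * kc R\<close> and \<open>k = kj R / 2\<close>, are the exceptional states for \<open>xi R \<le> 1 / 2\<close>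
(\<open>stationary_cases\<close>).

Conversely, two densities that belong to both regions and are exchanged by the two flows suffice
for a stationary state: at fixed \<open>k\<close> a region is an interval of densities, so the orbit cannot
leave it, and repeating the cycle gives an orbit for all times (\<open>can_have_stationaryI\<close>). Such
densities are written down explicitly. In \<open>(1, 7)\<close> and \<open>(3, 5)\<close> the demand of one ring has to balance
the supply of the other, and a short green time keeps the exponentials close to linear
(\<open>demand_supply_balance\<close>).\<close>

section \<open>Rates and regions\<close>

text \<open>\<open>slope\<close> and \<open>offset\<close> are the coefficients \<open>A\<close> and \<open>B\<close> of the affine equations, indexed by region so
that the two phases can be treated by the same lemmas. Regions 2 and 6 have slope 0, region 1 has
offset 0; they share the final default.\<close>

definition slope :: "road \<Rightarrow> nat \<Rightarrow> real" where
  "slope R i = (if i = 1 then - gamma1 R else if i = 3 then gamma2 R else if i = 4 then - gamma3 R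
     else if i = 5 then - gamma4 R else if i = 7 then gamma5 R else if i = 8 then - gamma3 R else 0)"

definition offset :: "road \<Rightarrow> real \<Rightarrow> nat \<Rightarrow> real" where
  "offset R k i = (if i = 2 then - gamma1 R * kc R else if i = 3 then - gamma2 R * kj R
     else if i = 4 then - gamma3 R * (kj R - 2 * k)
     else if i = 5 then 2 * k * gamma4 R else if i = 6 then gamma4 R * kc R
     else if i = 7 then gamma5 R * (kj R - 2 * k) else if i = 8 then gamma3 R * kj R else 0)"

definition drift :: "road \<Rightarrow> real \<Rightarrow> nat \<Rightarrow> real \<Rightarrow> real" where
  "drift R k i z = slope R i * z + offset R k i"

lemma valid_roadD:
  assumes "valid_road R"
  shows "0 < len R" "0 < vf R" "0 < kc R" "kc R < kj R" "0 < xi R" "xi R < 1" "0 < kj R"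
  using assms by (auto simp: valid_road_def)

lemma gamma_pos:
  assumes "valid_road R"
  shows "0 < gamma1 R" "0 < gamma2 R" "0 < gamma3 R" "0 < gamma4 R" "0 < gamma5 R"
  using valid_roadD[OF assms]
  by (auto simp: gamma1_def gamma2_def gamma3_def gamma4_def gamma5_def)

lemma gamma_ratios:
  assumes "valid_road R"
  shows "gamma1 R = gamma3 R * ((1 - xi R) * (kj R - kc R) / kc R)"
    and "gamma2 R = gamma3 R * ((1 - xi R) / xi R)"
  using valid_roadD[OF assms]
  by (auto simp: gamma1_def gamma2_def gamma3_def field_simps)

text \<open>In units of \<open>gamma3 R\<close> each drift is a multiple of a density or a vacancy of one of the rings, or the
constant flow at capacity; \<open>2 * k - z\<close> is the density of ring 2. Drifts of different regions are compared in these
units.\<close>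

lemma drift_normal_form:
  assumes "valid_road R"
  shows
    "drift R k 1 z = - gamma3 R * ((1 - xi R) * (kj R - kc R) / kc R * z)"
    "drift R k 2 z = - gamma3 R * ((1 - xi R) * (kj R - kc R))"
    "drift R k 3 z = - gamma3 R * ((1 - xi R) / xi R * (kj R - z))"
    "drift R k 4 z = - gamma3 R * (kj R - (2 * k - z))"
    "drift R k 5 z = gamma3 R * ((1 - xi R) * (kj R - kc R) / kc R * (2 * k - z))"
    "drift R k 6 z = gamma3 R * ((1 - xi R) * (kj R - kc R))"
    "drift R k 7 z = gamma3 R * ((1 - xi R) / xi R * (kj R - (2 * k - z)))"
    "drift R k 8 z = gamma3 R * (kj R - z)"
  using valid_roadD[OF assms]
  by (simp_all add: drift_def slope_def offset_def gamma4_def gamma5_def gamma_ratios[OF assms])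
    (simp_all add: field_simps)

text \<open>The two lines of the triangular diagram cross at the critical density, so truncating the argument
there selects a branch: the free-flow line for the demand, the congested one for the supply.\<close>

lemma ring_demand_eq:
  assumes "valid_road R"
  shows "ring_demand R x = vf R * min x (kc R)"
proof -
  note v = valid_roadD[OF assms]
  have "vf R * y \<le> vf R * kc R / (kj R - kc R) * (kj R - y)" if "y \<le> kc R" for y
  proof -
    have "y * kj R \<le> kc R * kj R" using that v by simp
    then have "y * (kj R - kc R) \<le> kc R * (kj R - y)" by (simp add: algebra_simps)
    then have "vf R * (y * (kj R - kc R)) \<le> vf R * (kc R * (kj R - y))"
      using v by simp
    then show ?thesis using v by (simp add: field_simps)
  qed
  from this[of "min x (kc R)"] show ?thesis by (simp add: ring_demand_def flow_def)
qed

lemma ring_supply_eq: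
  assumes "valid_road R"
  shows "ring_supply R x = vf R * kc R / (kj R - kc R) * (kj R - max x (kc R))"
proof -
  note v = valid_roadD[OF assms]
  have "vf R * kc R / (kj R - kc R) * (kj R - y) \<le> vf R * y" if "kc R \<le> y" for y
  proof -
    have "kc R * kj R \<le> y * kj R" using that v by simp
    then have "kc R * (kj R - y) \<le> y * (kj R - kc R)" by (simp add: algebra_simps)
    then have "vf R * (kc R * (kj R - y)) \<le> vf R * (y * (kj R - kc R))"
      using v by simp
    then show ?thesis using v by (simp add: field_simps)
  qed
  from this[of "max x (kc R)"] show ?thesis by (simp add: ring_supply_def flow_def)
qed

lemma rate_normal_form:
  assumes "valid_road R"
  shows
    "rate_one R k z = - gamma3 R *
       min ((1 - xi R) * (kj R - kc R) / kc R * min z (kc R))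
         (min ((1 - xi R) / xi R * (kj R - max z (kc R))) (kj R - max (2 * k - z) (kc R)))"
    "rate_two R k z = gamma3 R *
       min ((1 - xi R) * (kj R - kc R) / kc R * min (2 * k - z) (kc R))
         (min ((1 - xi R) / xi R * (kj R - max (2 * k - z) (kc R))) (kj R - max z (kc R)))"
proof -
  note v = valid_roadD[OF assms]
  have g: "0 \<le> gamma3 R" using gamma_pos[OF assms] by simp
  have a: "0 \<le> (1 - xi R) / len R" using v by simp
  have scale: "(1 - xi R) / len R * min p (min q r) = gamma3 R * min p' (min q' r')"
    if "(1 - xi R) / len R * p = gamma3 R * p'" "(1 - xi R) / len R * q = gamma3 R * q'"
      "(1 - xi R) / len R * r = gamma3 R * r'" for p q r p' q' r'
    using that by (simp add: min_mult_distrib_left a g)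
  have d: "(1 - xi R) / len R * ring_demand R x
      = gamma3 R * ((1 - xi R) * (kj R - kc R) / kc R * min x (kc R))" for x
    using v by (simp add: ring_demand_eq[OF assms] gamma3_def)
  have s: "(1 - xi R) / len R * (ring_supply R x / xi R)
      = gamma3 R * ((1 - xi R) / xi R * (kj R - max x (kc R)))"
    "(1 - xi R) / len R * (ring_supply R x / (1 - xi R)) = gamma3 R * (kj R - max x (kc R))" for x
    using v by (simp_all add: ring_supply_eq[OF assms] gamma3_def) (simp_all add: field_simps)
  show "rate_one R k z = - gamma3 R *
       min ((1 - xi R) * (kj R - kc R) / kc R * min z (kc R))
         (min ((1 - xi R) / xi R * (kj R - max z (kc R))) (kj R - max (2 * k - z) (kc R)))"
    using scale[OF d s(1) s(2)] unfolding rate_one_def by simp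
  show "rate_two R k z = gamma3 R *
       min ((1 - xi R) * (kj R - kc R) / kc R * min (2 * k - z) (kc R))
         (min ((1 - xi R) / xi R * (kj R - max (2 * k - z) (kc R))) (kj R - max z (kc R)))"
    using scale[OF d s(1) s(2)] unfolding rate_two_def by simp
qed

text \<open>Written in the densities of the two rings, with denominators cleared, the nontrivial boundaries
are the equalities between two terms of the minima in \<open>rate_normal_form\<close>. This is the form in
which membership is used and checked.\<close>

lemma region_iff:
  assumes "valid_road R"
  shows
    "(z, k) \<in> region R 1 \<longleftrightarrow> 0 < z \<and> z < kc R \<and> 0 \<le> 2 * k - z \<and>
       (1 - xi R) * (kj R - kc R) * z \<le> kc R * (kj R - (2 * k - z))"
    "(z, k) \<in> region R 2 \<longleftrightarrow> kc R \<le> z \<and> xi R * (kj R - kc R) < kj R - z \<and> 0 \<le> 2 * k - z \<and>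
       (1 - xi R) * (kj R - kc R) \<le> kj R - (2 * k - z)"
    "(z, k) \<in> region R 3 \<longleftrightarrow> kj R - z \<le> xi R * (kj R - kc R) \<and> z \<le> kj R \<and> 0 \<le> 2 * k - z \<and>
       (1 - xi R) * (kj R - z) \<le> xi R * (kj R - (2 * k - z))"
    "(z, k) \<in> region R 4 \<longleftrightarrow> 0 < z \<and> z < kj R \<and> 0 \<le> kj R - (2 * k - z) \<and>
       kc R * (kj R - (2 * k - z)) < (1 - xi R) * (kj R - kc R) * z \<and>
       kj R - (2 * k - z) < (1 - xi R) * (kj R - kc R) \<and>
       xi R * (kj R - (2 * k - z)) < (1 - xi R) * (kj R - z)"
    "(z, k) \<in> region R 5 \<longleftrightarrow> 0 \<le> z \<and> z \<le> kj R \<and> 0 \<le> 2 * k - z \<and> 2 * k - z \<le> kc R \<and>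
       (1 - xi R) * (kj R - kc R) * (2 * k - z) \<le> kc R * (kj R - z)"
    "(z, k) \<in> region R 6 \<longleftrightarrow> 0 \<le> z \<and> (1 - xi R) * (kj R - kc R) \<le> kj R - z \<and> kc R < 2 * k - z \<and>
       xi R * (kj R - kc R) \<le> kj R - (2 * k - z)"
    "(z, k) \<in> region R 7 \<longleftrightarrow> 0 \<le> z \<and> z \<le> kj R \<and> 0 \<le> kj R - (2 * k - z) \<and>
       kj R - (2 * k - z) < xi R * (kj R - kc R) \<and>
       (1 - xi R) * (kj R - (2 * k - z)) < xi R * (kj R - z)"
    "(z, k) \<in> region R 8 \<longleftrightarrow> kj R - z < (1 - xi R) * (kj R - kc R) \<and> z \<le> kj R \<and>
       kc R * (kj R - z) < (1 - xi R) * (kj R - kc R) * (2 * k - z) \<and>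
       xi R * (kj R - z) < (1 - xi R) * (kj R - (2 * k - z))"
proof -
  note v = valid_roadD[OF assms]
  \<comment> \<open>First boundary of regions 1 and 4: demand of ring 1 against supply of ring 2.\<close>
  have dem: "k \<le> kj R / 2 - ((1 - xi R) * kj R - (2 - xi R) * kc R) * z / (2 * kc R) \<longleftrightarrow>
     (1 - xi R) * (kj R - kc R) * z \<le> kc R * (kj R - (2 * k - z))"
    using v by (simp add: field_simps)
  \<comment> \<open>Boundary of regions 3 and 4: supply of ring 1 against supply of ring 2.\<close>
  have sup: "k \<le> (2 * xi R - 1) / (2 * xi R) * kj R + z / (2 * xi R) \<longleftrightarrow>
     (1 - xi R) * (kj R - z) \<le> xi R * (kj R - (2 * k - z))"
    using v by (simp add: field_simps)
  have m: "0 < (1 - xi R) * (kj R - kc R)" "0 < 1 - xi R" using v by simp_all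
  have half: "k \<le> z / 2 + t / (2 * m) \<longleftrightarrow> m * (2 * k - z) \<le> t" if "0 < m" for t m :: real
    using that by (simp add: field_simps)
  have dem2: "k \<le> z / 2 + kc R * (kj R - z) / (2 * (1 - xi R) * (kj R - kc R)) \<longleftrightarrow>
     (1 - xi R) * (kj R - kc R) * (2 * k - z) \<le> kc R * (kj R - z)"
    unfolding mult.assoc[of 2] using half[OF m(1)] .
  have "k < t / (2 * m) \<longleftrightarrow> 2 * k * m < t" "t / (2 * m) < k \<longleftrightarrow> t < 2 * k * m"
    if "0 < m" for t m :: real
    using that by (simp_all add: field_simps)
  from this[OF m(2), of "(1 - 2 * xi R) * kj R + z"]
  have sup2: "k < ((1 - 2 * xi R) * kj R + z) / (2 * (1 - xi R)) \<longleftrightarrow>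
     xi R * (kj R - z) < (1 - xi R) * (kj R - (2 * k - z))"
    "((1 - 2 * xi R) * kj R + z) / (2 * (1 - xi R)) < k \<longleftrightarrow>
     (1 - xi R) * (kj R - (2 * k - z)) < xi R * (kj R - z)"
    by (auto simp: algebra_simps)
  show "(z, k) \<in> region R 1 \<longleftrightarrow> 0 < z \<and> z < kc R \<and> 0 \<le> 2 * k - z \<and>
       (1 - xi R) * (kj R - kc R) * z \<le> kc R * (kj R - (2 * k - z))"
    by (simp only: region_def mem_Collect_eq prod.case dem if_True simp_thms) auto
  show "(z, k) \<in> region R 2 \<longleftrightarrow> kc R \<le> z \<and> xi R * (kj R - kc R) < kj R - z \<and> 0 \<le> 2 * k - z \<and>
       (1 - xi R) * (kj R - kc R) \<le> kj R - (2 * k - z)"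
    by (auto simp: region_def algebra_simps)
  show "(z, k) \<in> region R 3 \<longleftrightarrow> kj R - z \<le> xi R * (kj R - kc R) \<and> z \<le> kj R \<and> 0 \<le> 2 * k - z \<and>
       (1 - xi R) * (kj R - z) \<le> xi R * (kj R - (2 * k - z))"
    unfolding sup[symmetric] by (auto simp: region_def)
  show "(z, k) \<in> region R 4 \<longleftrightarrow> 0 < z \<and> z < kj R \<and> 0 \<le> kj R - (2 * k - z) \<and>
       kc R * (kj R - (2 * k - z)) < (1 - xi R) * (kj R - kc R) * z \<and>
       kj R - (2 * k - z) < (1 - xi R) * (kj R - kc R) \<and>
       xi R * (kj R - (2 * k - z)) < (1 - xi R) * (kj R - z)"
    unfolding not_le[symmetric] sup[symmetric] dem[symmetric] 
    by (auto simp: region_def not_le) (auto simp: algebra_simps)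
  show "(z, k) \<in> region R 5 \<longleftrightarrow> 0 \<le> z \<and> z \<le> kj R \<and> 0 \<le> 2 * k - z \<and> 2 * k - z \<le> kc R \<and>
       (1 - xi R) * (kj R - kc R) * (2 * k - z) \<le> kc R * (kj R - z)"
    unfolding dem2[symmetric] by (auto simp: region_def)
  show "(z, k) \<in> region R 6 \<longleftrightarrow> 0 \<le> z \<and> (1 - xi R) * (kj R - kc R) \<le> kj R - z \<and> kc R < 2 * k - z \<and>
       xi R * (kj R - kc R) \<le> kj R - (2 * k - z)"
    by (auto simp: region_def)
  show "(z, k) \<in> region R 7 \<longleftrightarrow> 0 \<le> z \<and> z \<le> kj R \<and> 0 \<le> kj R - (2 * k - z) \<and>
       kj R - (2 * k - z) < xi R * (kj R - kc R) \<and>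
       (1 - xi R) * (kj R - (2 * k - z)) < xi R * (kj R - z)"
    unfolding sup2(2)[symmetric] by (auto simp: region_def)
  show "(z, k) \<in> region R 8 \<longleftrightarrow> kj R - z < (1 - xi R) * (kj R - kc R) \<and> z \<le> kj R \<and>
       kc R * (kj R - z) < (1 - xi R) * (kj R - kc R) * (2 * k - z) \<and>
       xi R * (kj R - z) < (1 - xi R) * (kj R - (2 * k - z))"
    unfolding sup2(1)[symmetric] using dem2 by (auto simp: region_def not_le)
qed

text \<open>Bounds on the densities that a region does not list follow from its other inequalities,
by comparing signs. They make every point of a region an admissible state of an orbit.\<close>

lemma region_range:
  assumes R: "valid_road R" and z: "(z, k) \<in> region R i"
  shows "z \<in> {0..kj R}" "2 * k - z \<in> {0..kj R}"
proof -
  note v = valid_roadD[OF R]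
  define m where "m = (1 - xi R) * (kj R - kc R)"
  have m: "0 < m" "m < kj R - kc R" using v by (auto simp: m_def)
  define n where "n = xi R * (kj R - kc R)"
  have n: "0 < n" "n < kj R - kc R" using v by (simp_all add: n_def)
  note reg = region_iff[OF R, folded m_def n_def]
  have nonneg: "0 \<le> s" if "0 < p" "0 \<le> p * s" for p s :: real
    using that by (simp add: zero_le_mult_iff)
  have "i \<in> {1, 2, 3, 4, 5, 6, 7, 8}" using z by (auto simp: region_def split: if_splits)
  then consider "i = 1" | "i = 2" | "i = 3" | "i = 4" | "i = 5" | "i = 6" | "i = 7" | "i = 8" by blast
  then have "z \<in> {0..kj R} \<and> 2 * k - z \<in> {0..kj R}"
  proof cases
    case 1
    have h: "0 < z" "z < kc R" "0 \<le> 2 * k - z" "m * z \<le> kc R * (kj R - (2 * k - z))"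
      using z[unfolded 1 reg] by auto
    then have "0 \<le> kj R - (2 * k - z)" using nonneg[OF v(3)] m
      by (meson mult_nonneg_nonneg less_imp_le order_trans)
    then show ?thesis using h v by simp
  next
    case 3
    have h: "kj R - z \<le> n" "z \<le> kj R" "0 \<le> 2 * k - z"
      "(1 - xi R) * (kj R - z) \<le> xi R * (kj R - (2 * k - z))" using z[unfolded 3 reg] by auto
    have "0 \<le> (1 - xi R) * (kj R - z)" using h v by simp
    then have "0 \<le> kj R - (2 * k - z)" using nonneg[OF v(5)] h by (meson order_trans)
    then show ?thesis using h v n by simp
  next
    case 8
    have h: "kj R - z < m" "z \<le> kj R" "kc R * (kj R - z) < m * (2 * k - z)"
      "xi R * (kj R - z) < (1 - xi R) * (kj R - (2 * k - z))" using z[unfolded 8 reg] by auto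
    have "0 \<le> kc R * (kj R - z)" "0 \<le> xi R * (kj R - z)" using h v by simp_all
    then have prods: "0 \<le> m * (2 * k - z)" "0 \<le> (1 - xi R) * (kj R - (2 * k - z))" using h by linarith+
    have "0 \<le> 2 * k - z" by (rule nonneg[OF m(1) prods(1)])
    moreover have "0 \<le> kj R - (2 * k - z)" by (rule nonneg[OF _ prods(2)]) (use v in simp)
    ultimately show ?thesis using h(1,2) v m by simp
  qed (use z v m n in \<open>auto simp: reg\<close>)
  then show "z \<in> {0..kj R}" "2 * k - z \<in> {0..kj R}" by auto
qed

text \<open>The inequalities of a region identify the smallest of the demand and the two supplies; the drift is
the corresponding term.\<close>

lemma rate_one_in_region:
  assumes "valid_road R" "i \<in> {1, 2, 3, 4}" "(z, k) \<in> region R i"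
  shows "rate_one R k z = drift R k i z"
proof -
  note v = valid_roadD[OF assms(1)]
  define m where "m = (1 - xi R) * (kj R - kc R)"
  define \<rho> where "\<rho> = (1 - xi R) / xi R"
  have m: "0 < m" "m < kj R - kc R" using v by (auto simp: m_def)
  have r: "\<rho> * (xi R * x) = (1 - xi R) * x" "0 < \<rho>" for x using v by (auto simp: \<rho>_def)
  have m_sup: "m \<le> \<rho> * (kj R - kc R)"
  proof -
    have "(1 - xi R) * xi R \<le> 1 - xi R" using v by (simp add: mult_left_le)
    then have "1 - xi R \<le> \<rho>" using v by (simp add: \<rho>_def field_simps)
    then show ?thesis using v by (simp add: m_def)
  qed
  have dem: "m / kc R * x \<le> y \<longleftrightarrow> m * x \<le> kc R * y" for x y using v by (simp add: field_simps)
  have sup: "\<rho> * x \<le> y \<longleftrightarrow> (1 - xi R) * x \<le> xi R * y" for x y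
    using v by (simp add: \<rho>_def field_simps)
  have full: "m / kc R * kc R = m" using v by simp
  note nf = rate_normal_form(1)[OF assms(1), folded m_def \<rho>_def]
  note d = drift_normal_form[OF assms(1), folded m_def \<rho>_def]
  note reg = region_iff[OF assms(1), folded m_def]
  consider "i = 1" | "i = 2" | "i = 3" | "i = 4" using assms(2) by auto
  then show ?thesis
  proof cases
    case 1
    with assms(3) have h: "0 < z" "z < kc R" "m * z \<le> kc R * (kj R - (2 * k - z))"
      using reg(1) by auto
    have "m / kc R * z \<le> m"
      using mult_left_mono[of z "kc R" "m / kc R"] h m v full by simp
    moreover have "m / kc R * z \<le> kj R - (2 * k - z)" using h dem by blast
    ultimately show ?thesis
      using h m m_sup unfolding 1 d nf by (simp add: min_def max_def)
  next
    case 2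
    with assms(3) have h: "kc R \<le> z" "xi R * (kj R - kc R) < kj R - z" "m \<le> kj R - (2 * k - z)"
      using reg(2) by auto
    have "m \<le> \<rho> * (kj R - z)"
      using mult_left_mono[OF less_imp_le[OF h(2)], of \<rho>] r by (simp add: m_def)
    then show ?thesis
      using h m full m_sup unfolding 2 d nf by (auto simp: min_def max_def)
  next
    case 3
    with assms(3) have h: "kj R - z \<le> xi R * (kj R - kc R)"
      "(1 - xi R) * (kj R - z) \<le> xi R * (kj R - (2 * k - z))"
      using reg(3) by auto
    have "xi R * (kj R - kc R) < kj R - kc R" using v by simp
    then have "kc R \<le> z" using h(1) by linarith
    moreover have "\<rho> * (kj R - z) \<le> m"
      using mult_left_mono[OF h(1), of \<rho>] r by (simp add: m_def)
    moreover have "\<rho> * (kj R - z) \<le> kj R - (2 * k - z)" using h sup by blast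
    ultimately show ?thesis
      using m full v unfolding 3 d nf by (auto simp: min_def max_def)
  next
    case 4
    with assms(3) have h: "kc R * (kj R - (2 * k - z)) < m * z" "kj R - (2 * k - z) < m"
      "xi R * (kj R - (2 * k - z)) < (1 - xi R) * (kj R - z)"
      using reg(4) by auto
    have "kj R - (2 * k - z) \<le> m / kc R * z" using h(1) dem by (meson not_le less_imp_le)
    moreover have "kj R - (2 * k - z) \<le> \<rho> * (kj R - z)"
      using h(3) sup by (meson not_le less_imp_le)
    moreover have "kc R \<le> 2 * k - z" using h(2) m by linarith
    ultimately show ?thesis
      using h(2) m full m_sup unfolding 4 d nf by (simp add: min_def max_def)
  qed
qed

lemma rate_two_in_region:
  assumes "valid_road R" "i \<in> {5, 6, 7, 8}" "(z, k) \<in> region R i"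
  shows "rate_two R k z = drift R k i z"
proof -
  note v = valid_roadD[OF assms(1)]
  define m where "m = (1 - xi R) * (kj R - kc R)"
  define \<rho> where "\<rho> = (1 - xi R) / xi R"
  have m: "0 < m" "m < kj R - kc R" using v by (auto simp: m_def)
  have r: "\<rho> * (xi R * x) = (1 - xi R) * x" "0 < \<rho>" for x using v by (auto simp: \<rho>_def)
  have m_sup: "m \<le> \<rho> * (kj R - kc R)"
  proof -
    have "(1 - xi R) * xi R \<le> 1 - xi R" using v by (simp add: mult_left_le)
    then have "1 - xi R \<le> \<rho>" using v by (simp add: \<rho>_def field_simps)
    then show ?thesis using v by (simp add: m_def)
  qed
  have dem: "m / kc R * x \<le> y \<longleftrightarrow> m * x \<le> kc R * y" for x y using v by (simp add: field_simps)
  have sup: "\<rho> * x \<le> y \<longleftrightarrow> (1 - xi R) * x \<le> xi R * y" for x y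
    using v by (simp add: \<rho>_def field_simps)
  have full: "m / kc R * kc R = m" using v by simp
  have sup_lt: "xi R * (kj R - kc R) < kj R - kc R" using v by simp
  note nf = rate_normal_form(2)[OF assms(1), folded m_def \<rho>_def]
  note d = drift_normal_form[OF assms(1), folded m_def \<rho>_def]
  note reg = region_iff[OF assms(1), folded m_def]
  consider "i = 5" | "i = 6" | "i = 7" | "i = 8" using assms(2) by auto
  then show ?thesis
  proof cases
    case 1
    with assms(3) have h: "0 \<le> 2 * k - z" "2 * k - z \<le> kc R" "m * (2 * k - z) \<le> kc R * (kj R - z)"
      using reg(5) by auto
    have "m / kc R * (2 * k - z) \<le> m"
      using mult_left_mono[of "2 * k - z" "kc R" "m / kc R"] h m v full by simp
    moreover have "m / kc R * (2 * k - z) \<le> kj R - z" using h dem by blast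
    ultimately show ?thesis
      using h m m_sup unfolding 1 d nf by (simp add: min_def max_def)
  next
    case 2
    with assms(3) have h: "m \<le> kj R - z" "kc R < 2 * k - z" "xi R * (kj R - kc R) \<le> kj R - (2 * k - z)"
      using reg(6) by auto
    have "m \<le> \<rho> * (kj R - (2 * k - z))"
      using mult_left_mono[OF h(3), of \<rho>] r by (simp add: m_def)
    then show ?thesis
      using h m full m_sup unfolding 2 d nf by (auto simp: min_def max_def)
  next
    case 3
    with assms(3) have h: "kj R - (2 * k - z) < xi R * (kj R - kc R)"
      "(1 - xi R) * (kj R - (2 * k - z)) < xi R * (kj R - z)"
      using reg(7) by auto
    have "kc R \<le> 2 * k - z" using h(1) sup_lt by linarith
    moreover have "\<rho> * (kj R - (2 * k - z)) \<le> m"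
      using mult_left_mono[OF less_imp_le[OF h(1)], of \<rho>] r by (simp add: m_def)
    moreover have "\<rho> * (kj R - (2 * k - z)) \<le> kj R - z" using h sup by (meson less_imp_le)
    ultimately show ?thesis
      using m full v unfolding 3 d nf by (auto simp: min_def max_def)
  next
    case 4
    with assms(3) have h: "kj R - z < m" "kc R * (kj R - z) < m * (2 * k - z)" 
      "xi R * (kj R - z) < (1 - xi R) * (kj R - (2 * k - z))"
      using reg(8) by auto
    have "kj R - z \<le> m / kc R * (2 * k - z)" using h(2) dem by (meson not_le less_imp_le)
    moreover have "kj R - z \<le> \<rho> * (kj R - (2 * k - z))"
      using h(3) sup by (meson not_le less_imp_le)
    moreover have "kc R \<le> z" using h(1) m by linarith
    ultimately show ?thesis
      using h(1) m full m_sup unfolding 4 d nf by (simp add: min_def max_def)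
  qed
qed

section \<open>Uniqueness of orbits\<close>

lemma lipschitz_on_clip:
  fixes c :: real shows "1-lipschitz_on U (\<lambda>x. min x c)" "1-lipschitz_on U (\<lambda>x. max x c)"
  by (auto intro!: lipschitz_onI simp: dist_real_def min_def max_def abs_if)

lemma lipschitz_on_min:
  fixes f g :: "'a::metric_space \<Rightarrow> real"
  assumes "C-lipschitz_on U f" "D-lipschitz_on U g"
  shows "(C + D)-lipschitz_on U (\<lambda>x. min (f x) (g x))"
proof (rule lipschitz_onI)
  have nn: "0 \<le> C" "0 \<le> D" using assms lipschitz_on_nonneg by auto
  then show "0 \<le> C + D" by simp
  fix x y assume "x \<in> U" "y \<in> U"
  then have "\<bar>f x - f y\<bar> \<le> C * dist x y" "\<bar>g x - g y\<bar> \<le> D * dist x y"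
    using lipschitz_onD[OF assms(1)] lipschitz_onD[OF assms(2)] by (auto simp: dist_real_def)
  then show "dist (min (f x) (g x)) (min (f y) (g y)) \<le> (C + D) * dist x y"
    unfolding dist_real_def distrib_right by linarith
qed

text \<open>The rates have kinks on the boundaries between regions, but truncation and minimum preserve the
Lipschitz property, so solutions are unique also when they change region.\<close>

lemma rate_lipschitz:
  assumes "valid_road R"
  shows "\<exists>C. C-lipschitz_on UNIV (rate_one R k)" "\<exists>C. C-lipschitz_on UNIV (rate_two R k)"
proof -
  have flip: "1-lipschitz_on UNIV (\<lambda>z::real. min (2 * k - z) (kc R))"
    "1-lipschitz_on UNIV (\<lambda>z::real. max (2 * k - z) (kc R))"
    by (auto intro!: lipschitz_onI simp: dist_real_def min_def max_def abs_if)
  note rules = lipschitz_on_cmult_real lipschitz_on_min lipschitz_on_diff lipschitz_on_constant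
    lipschitz_on_clip flip
  show "\<exists>C. C-lipschitz_on UNIV (rate_one R k)" "\<exists>C. C-lipschitz_on UNIV (rate_two R k)"
    unfolding rate_normal_form[OF assms, abs_def] by (rule exI, (rule rules)+)+
qed

text \<open>Gronwall's argument: the squared distance of two solutions, discounted at twice the Lipschitz
constant, cannot increase. Derivatives are assumed in the open interval only; at the first instant
of a phase an orbit has just a one-sided derivative.\<close>

lemma ode_solution_unique:
  fixes f g r :: "real \<Rightarrow> real"
  assumes "C-lipschitz_on UNIV r" and "a \<le> b"
    and cont: "continuous_on {a..b} f" "continuous_on {a..b} g"
    and f: "\<And>t. a < t \<Longrightarrow> t < b \<Longrightarrow> (f has_real_derivative r (f t)) (at t)"
    and g: "\<And>t. a < t \<Longrightarrow> t < b \<Longrightarrow> (g has_real_derivative r (g t)) (at t)"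
    and "f a = g a"
  shows "f b = g b"
proof -
  define E where "E t = (f t - g t)\<^sup>2 * exp (- (2 * C * t))" for t
  have "E b \<le> E a"
  proof (rule DERIV_nonpos_imp_decreasing_open[of a b E])
    show "continuous_on {a..b} E"
      unfolding E_def by (intro continuous_intros cont)
    fix t assume t: "a < t" "t < b"
    let ?D = "2 * ((f t - g t) * (r (f t) - r (g t)) - C * (f t - g t)\<^sup>2) * exp (- (2 * C * t))"
    have "(E has_real_derivative ?D) (at t)"
      unfolding E_def[abs_def]
      by (rule derivative_eq_intros f[OF t] g[OF t] refl)+ (simp add: algebra_simps power2_eq_square)
    moreover have "(f t - g t) * (r (f t) - r (g t)) \<le> C * (f t - g t)\<^sup>2"
    proof -
      have "(f t - g t) * (r (f t) - r (g t)) \<le> \<bar>f t - g t\<bar> * \<bar>r (f t) - r (g t)\<bar>"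
        by (metis abs_ge_self abs_mult)
      also have "\<dots> \<le> \<bar>f t - g t\<bar> * (C * \<bar>f t - g t\<bar>)"
        using lipschitz_onD[OF assms(1), of "f t" "g t"] by (intro mult_left_mono) (auto simp: dist_real_def)
      finally show ?thesis by (simp add: power2_eq_square mult.left_commute)
    qed
    ultimately show "\<exists>y. (E has_real_derivative y) (at t) \<and> y \<le> 0"
      by (intro exI[of _ ?D] conjI) (auto intro!: mult_nonpos_nonneg)
  qed (use assms in auto)
  moreover have "E a = 0" using assms by (simp add: E_def)
  ultimately have "(f b - g b)\<^sup>2 \<le> 0" by (simp add: E_def mult_le_0_iff)
  then show ?thesis by simp
qed

text \<open>The two green phases of one cycle, each on its own clock \<open>{0..g}\<close>. The lost times between them only
require that \<open>h\<close> starts where \<open>f\<close> ends, so neither the number of the cycle nor the length of the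
lost time occurs.\<close>

definition cycle_pieces :: "road \<Rightarrow> real \<Rightarrow> real \<Rightarrow> (real \<Rightarrow> real) \<Rightarrow> (real \<Rightarrow> real) \<Rightarrow> bool" where
  "cycle_pieces R k g f h \<longleftrightarrow> continuous_on {0..g} f \<and> continuous_on {0..g} h \<and> h 0 = f g \<and>
     (\<forall>s. 0 < s \<longrightarrow> s < g \<longrightarrow> (f has_real_derivative rate_one R k (f s)) (at s) \<and>
        (h has_real_derivative rate_two R k (h s)) (at s))"

lemma cycle_pieces_unique:
  assumes "valid_road R" "0 \<le> g"
    and "cycle_pieces R k g f h" "cycle_pieces R k g f' h'" "f 0 = f' 0"
  shows "h g = h' g"
proof -
  obtain C D where "C-lipschitz_on UNIV (rate_one R k)" "D-lipschitz_on UNIV (rate_two R k)"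
    using rate_lipschitz[OF assms(1)] by blast
  note uniq = ode_solution_unique[OF this(1)] ode_solution_unique[OF this(2)]
  have "f g = f' g"
    by (rule uniq(1)[of 0 g f f']) (use assms in \<open>auto simp: cycle_pieces_def\<close>)
  then show ?thesis
    by (intro uniq(2)[of 0 g h h']) (use assms in \<open>auto simp: cycle_pieces_def\<close>)
qed

lemma valid_signalD:
  assumes "valid_signal S"
  shows "0 < cyc S" "0 \<le> lost S" "0 < green_time S" "cyc S = 2 * green_time S + 2 * lost S"
  using assms by (auto simp: valid_signal_def green_time_def)

lemma orbit_cycle_pieces:
  fixes n :: nat
  assumes "valid_signal S" and orb: "orbit R S k u"
  defines "c \<equiv> real n * cyc S" and "g \<equiv> green_time S"
  shows "cycle_pieces R k g (\<lambda>s. u (c + s)) (\<lambda>s. u (c + g + lost S + s))"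
    and "u (c + g + lost S + g) = u ((real n + 1) * cyc S)"
proof -
  note sv = valid_signalD[OF assms(1), folded g_def]
  have c0: "0 \<le> c" using sv by (simp add: c_def)
  have cont: "continuous_on {0..} u" using orb by (simp add: orbit_def)
  have next_c: "(real n + 1) * cyc S = c + cyc S" by (simp add: c_def algebra_simps)
  \<comment> \<open>A lost time is half-open; continuity carries its constant value to the right end.\<close>
  have hold: "u b = u a" if "0 \<le> a" "a \<le> b" "\<forall>t\<in>{a..<b}. u t = u a" for a b
  proof (cases "a = b")
    case False
    then have cl: "closure {a..<b} = {a..b}" using that by simp
    have "continuous_on (closure {a..<b}) u"
      unfolding cl by (rule continuous_on_subset[OF cont]) (use that in auto)
    then show ?thesis
    proof (rule continuous_constant_on_closure)
      show "u t = u a" if "t \<in> {a..<b}" for t using \<open>\<forall>t\<in>{a..<b}. u t = u a\<close> that by blast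
      show "b \<in> closure {a..<b}" unfolding cl using \<open>a \<le> b\<close> by simp
    qed
  qed simp
  have shift: "((\<lambda>s. u (a + s)) has_real_derivative d (u (a + s))) (at s)"
    if "\<forall>t\<in>{a..<a + g}. (u has_real_derivative d (u t)) (at t within {a..<a + g})" "0 < s" "s < g"
    for d a s
  proof -
    have "at (a + s) within {a..<a + g} = at (a + s)"
      by (rule at_within_open_subset[of _ "{a<..<a + g}"]) (use that in auto)
    moreover have "(u has_real_derivative d (u (a + s))) (at (a + s) within {a..<a + g})"
      using that by auto
    ultimately have "(u has_real_derivative d (u (a + s))) (at (s + a))"
      by (simp add: add.commute)
    then have "((\<lambda>s. u (s + a)) has_real_derivative d (u (a + s))) (at s)"
      by (simp only: DERIV_shift)
    then show ?thesis by (simp only: add.commute)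
  qed
  have cont_shift: "continuous_on {0..g} (\<lambda>s. u (a + s))" if "0 \<le> a" for a
    by (rule continuous_on_compose2[OF cont]) (use that in \<open>auto intro!: continuous_intros\<close>)
  have one: "phase_one S n = {c..<c + g}" by (simp add: phase_one_def c_def g_def)
  have two: "phase_two S n = {c + g + lost S..<c + g + lost S + g}"
    using sv(4) by (auto simp: phase_two_def c_def g_def algebra_simps)
  have "\<forall>t\<in>lost_one S n. u t = u (c + g)"
    "\<forall>t\<in>lost_two S n. u t = u ((real n + 1) * cyc S - lost S)"
    and der: "\<forall>t\<in>phase_one S n. (u has_real_derivative rate_one R k (u t)) (at t within phase_one S n)"
    "\<forall>t\<in>phase_two S n. (u has_real_derivative rate_two R k (u t)) (at t within phase_two S n)"
    using orb unfolding orbit_def c_def g_def by blast+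
  note held = this(1,2)[unfolded lost_one_def lost_two_def, folded c_def g_def]
  have l1: "u (c + g + lost S) = u (c + g)"
    by (rule hold[OF _ _ held(1)]) (use c0 sv in auto)
  have "u ((real n + 1) * cyc S) = u ((real n + 1) * cyc S - lost S)"
    by (rule hold[OF _ _ held(2)]) (use c0 sv next_c in auto)
  also have "(real n + 1) * cyc S - lost S = c + g + lost S + g"
    unfolding next_c using sv(4) by simp
  finally show "u (c + g + lost S + g) = u ((real n + 1) * cyc S)" ..
  show "cycle_pieces R k g (\<lambda>s. u (c + s)) (\<lambda>s. u (c + g + lost S + s))"
    unfolding cycle_pieces_def
    using shift[OF der(1)[unfolded one]] shift[OF der(2)[unfolded two]] l1 c0 sv
    by (auto intro!: cont_shift)
qed

text \<open>The equations of a phase do not depend on the number of the cycle, so two orbits that pass through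
the same density at the beginnings of two cycles agree at the ends of these cycles. Hence the
description in \<open>poincare\<close> has a unique solution.\<close>

lemma poincare_orbit:
  assumes "valid_road R" "valid_signal S" "orbit R S k u"
  shows "poincare R S k (u (real n * cyc S)) = u ((real n + 1) * cyc S)"
  unfolding poincare_def
proof (rule the_equality)
  show "\<exists>u' m. orbit R S k u' \<and> u' (real m * cyc S) = u (real n * cyc S) \<and>
     u' ((real m + 1) * cyc S) = u ((real n + 1) * cyc S)"
    using assms by blast
  fix y assume "\<exists>u' m. orbit R S k u' \<and> u' (real m * cyc S) = u (real n * cyc S) \<and>
     u' ((real m + 1) * cyc S) = y"
  then obtain u' m where u': "orbit R S k u'" "u' (real m * cyc S) = u (real n * cyc S)"
     "u' ((real m + 1) * cyc S) = y" by blast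
  note p = orbit_cycle_pieces[OF assms(2,3), of n]
  note q = orbit_cycle_pieces[OF assms(2) u'(1), of m]
  show "y = u ((real n + 1) * cyc S)"
    using cycle_pieces_unique[OF assms(1) _ q(1) p(1)] valid_signalD[OF assms(2)] u' p(2) q(2)
    by simp
qed

section \<open>Flow of a single region\<close>

text \<open>The integral of \<open>exp (A * t)\<close> over \<open>{0..s}\<close>. Dealing with \<open>A = 0\<close> here keeps regions 2 and 6 out of all
later case distinctions.\<close>

definition growth :: "real \<Rightarrow> real \<Rightarrow> real" where
  "growth A s = (if A = 0 then s else (exp (A * s) - 1) / A)"

text \<open>The position at time \<open>s\<close> of the solution that starts at \<open>x\<close>. Along it the drift is multiplied by
\<open>exp (slope R i * s)\<close> (\<open>drift_region_flow\<close>), so the displacement is the initial drift times the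
integral of this factor. In particular a solution is either constant or strictly monotone.\<close>

definition region_flow :: "road \<Rightarrow> real \<Rightarrow> nat \<Rightarrow> real \<Rightarrow> real \<Rightarrow> real" where
  "region_flow R k i s x = x + drift R k i x * growth (slope R i) s"

lemma growth_0 [simp]: "growth A 0 = 0"
  by (simp add: growth_def)

lemma growth_exp: "A * growth A s = exp (A * s) - 1"
  by (simp add: growth_def)

lemma growth_deriv: "(growth A has_real_derivative exp (A * s)) (at s)"
proof (cases "A = 0")
  case False
  then have "((\<lambda>s. (exp (A * s) - 1) / A) has_real_derivative exp (A * s)) (at s)"
    by (auto intro!: derivative_eq_intros)
  with False show ?thesis by (simp add: growth_def[abs_def])
qed (simp add: growth_def[abs_def])

lemma growth_strict_mono: "s < t \<Longrightarrow> growth A s < growth A t"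
  using DERIV_pos_imp_increasing[of s t "growth A"] growth_deriv exp_gt_zero by blast

lemma region_flow_0 [simp]: "region_flow R k i 0 x = x"
  by (simp add: region_flow_def)

lemma drift_diff: "drift R k i a - drift R k i b = slope R i * (a - b)"
  by (simp add: drift_def algebra_simps)

lemma drift_region_flow:
  "drift R k i (region_flow R k i s x) = drift R k i x * exp (slope R i * s)"
proof -
  have "drift R k i (region_flow R k i s x) = drift R k i x + slope R i * (drift R k i x * growth (slope R i) s)"
    by (simp add: drift_def region_flow_def algebra_simps)
  also have "\<dots> = drift R k i x * (1 + slope R i * growth (slope R i) s)" by algebra
  finally show ?thesis by (simp add: growth_exp)
qed

lemma region_flow_deriv:
  "((\<lambda>s. region_flow R k i s x) has_real_derivative drift R k i (region_flow R k i s x)) (at s)"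
  unfolding drift_region_flow unfolding region_flow_def
  by (auto intro!: derivative_eq_intros growth_deriv)

lemma region_flow_continuous: "continuous_on A (\<lambda>s. region_flow R k i s x)"
  by (rule DERIV_continuous_on[OF has_field_derivative_at_within[OF region_flow_deriv]])

lemma region_flow_unique:
  assumes "0 \<le> g" "continuous_on {0..g} f"
    and "\<And>s. 0 < s \<Longrightarrow> s < g \<Longrightarrow> (f has_real_derivative drift R k i (f s)) (at s)"
  shows "f g = region_flow R k i g (f 0)"
proof (rule ode_solution_unique[of "\<bar>slope R i\<bar>" "drift R k i" 0 g f
      "\<lambda>s. region_flow R k i s (f 0)"])
  show "\<bar>slope R i\<bar>-lipschitz_on UNIV (drift R k i)"
    by (rule lipschitz_onI) (simp_all add: dist_real_def drift_diff abs_mult)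
  show "continuous_on {0..g} (\<lambda>s. region_flow R k i s (f 0))" by (rule region_flow_continuous)
  show "((\<lambda>s. region_flow R k i s (f 0)) has_real_derivative drift R k i (region_flow R k i s (f 0))) (at s)"
    for s by (rule region_flow_deriv)
qed (use assms in simp_all)

text \<open>Staying in one region during each phase turns the piecewise equation into two affine ones, whose
solutions are known. The witnessing orbit is thereby replaced by two explicit flows.\<close>

lemma combinationD:
  assumes R: "valid_road R" and S: "valid_signal S" and x: "x \<in> combination R S k i j"
  defines "g \<equiv> green_time S"
  defines "y \<equiv> region_flow R k i g x"
  shows "i \<in> {1, 2, 3, 4}" "j \<in> {5, 6, 7, 8}"
    and "poincare R S k x = region_flow R k j g y"
    and "\<And>s. 0 \<le> s \<Longrightarrow> s < g \<Longrightarrow> (region_flow R k i s x, k) \<in> region R i"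
    and "\<And>s. 0 \<le> s \<Longrightarrow> s < g \<Longrightarrow> (region_flow R k j s y, k) \<in> region R j"
proof -
  note sv = valid_signalD[OF S, folded g_def]
  obtain u n where ij: "i \<in> {1, 2, 3, 4}" "j \<in> {5, 6, 7, 8}" and orb: "orbit R S k u"
    and u: "u (real n * cyc S) = x"
    and reg: "\<forall>t\<in>phase_one S n. (u t, k) \<in> region R i" "\<forall>t\<in>phase_two S n. (u t, k) \<in> region R j"
    using x unfolding combination_def by blast
  define f h where "f s = u (real n * cyc S + s)" and "h s = u (real n * cyc S + g + lost S + s)" for s
  note cp = orbit_cycle_pieces[OF S orb, of n, folded g_def, folded f_def[abs_def] h_def[abs_def]]
  have f0: "f 0 = x" using u by (simp add: f_def)
  have hg: "h g = poincare R S k x"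
    using cp(2) poincare_orbit[OF R S orb, of n] u by (simp add: h_def)
  have f: "(f s, k) \<in> region R i" if "0 \<le> s" "s < g" for s
    unfolding f_def by (rule reg(1)[rule_format]) (use that in \<open>auto simp: phase_one_def g_def\<close>)
  have "real n * cyc S + g + lost S + s < (real n + 1) * cyc S - lost S" if "s < g" for s
    using that sv(4) by (simp add: algebra_simps)
  then have h: "(h s, k) \<in> region R j" if "0 \<le> s" "s < g" for s
    unfolding h_def by (intro reg(2)[rule_format]) (use that in \<open>auto simp: phase_two_def g_def\<close>)
  have f_eq: "f s = region_flow R k i s x" if "0 \<le> s" "s \<le> g" for s
    unfolding f0[symmetric]
  proof (rule region_flow_unique)
    show "continuous_on {0..s} f" using cp(1) that
      by (auto simp: cycle_pieces_def intro: continuous_on_subset)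
    show "(f has_real_derivative drift R k i (f t)) (at t)" if "0 < t" "t < s" for t
      using rate_one_in_region[OF R ij(1) f, of t] cp(1) that \<open>s \<le> g\<close> by (auto simp: cycle_pieces_def)
  qed (use that in auto)
  have h0: "h 0 = y" using cp(1) f_eq sv by (simp add: cycle_pieces_def y_def)
  have h_eq: "h s = region_flow R k j s y" if "0 \<le> s" "s \<le> g" for s
    unfolding h0[symmetric]
  proof (rule region_flow_unique)
    show "continuous_on {0..s} h" using cp(1) that
      by (auto simp: cycle_pieces_def intro: continuous_on_subset)
    show "(h has_real_derivative drift R k j (h t)) (at t)" if "0 < t" "t < s" for t
      using rate_two_in_region[OF R ij(2) h, of t] cp(1) that \<open>s \<le> g\<close> by (auto simp: cycle_pieces_def)
  qed (use that in auto)
  show "i \<in> {1, 2, 3, 4}" "j \<in> {5, 6, 7, 8}" by fact+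
  show "poincare R S k x = region_flow R k j g y" using hg h_eq sv by simp
  show "(region_flow R k i s x, k) \<in> region R i" if "0 \<le> s" "s < g" for s
    using f f_eq that by simp
  show "(region_flow R k j s y, k) \<in> region R j" if "0 \<le> s" "s < g" for s
    using h h_eq that by simp
qed

section \<open>Poincare maps and their fixed points\<close>

text \<open>Except in regions 2 and 6 the drift vanishes at one density \<open>e\<close>, and the distance from \<open>e\<close> grows or
decays exponentially.\<close>

lemma region_flow_closed_form:
  assumes "valid_road R"
  shows
    "region_flow R k 1 s x = x * exp (- (gamma1 R * s))"
    "region_flow R k 2 s x = x - gamma1 R * kc R * s"
    "region_flow R k 3 s x = kj R + (x - kj R) * exp (gamma2 R * s)"
    "region_flow R k 4 s x = 2 * k - kj R + (x - (2 * k - kj R)) * exp (- (gamma3 R * s))"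
    "region_flow R k 5 s x = 2 * k + (x - 2 * k) * exp (- (gamma1 R * s))"
    "region_flow R k 6 s x = x + gamma1 R * kc R * s"
    "region_flow R k 7 s x = 2 * k - kj R + (x - (2 * k - kj R)) * exp (gamma2 R * s)"
    "region_flow R k 8 s x = kj R + (x - kj R) * exp (- (gamma3 R * s))"
proof -
  have eq: "region_flow R k i s x = e + (x - e) * exp (slope R i * s)"
    if "drift R k i x = (x - e) * slope R i" for i e
  proof -
    have "region_flow R k i s x = x + (x - e) * (slope R i * growth (slope R i) s)"
      by (simp add: region_flow_def that)
    then show ?thesis unfolding growth_exp by (simp add: algebra_simps)
  qed
  show
    "region_flow R k 1 s x = x * exp (- (gamma1 R * s))"
    "region_flow R k 3 s x = kj R + (x - kj R) * exp (gamma2 R * s)"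
    "region_flow R k 4 s x = 2 * k - kj R + (x - (2 * k - kj R)) * exp (- (gamma3 R * s))"
    "region_flow R k 5 s x = 2 * k + (x - 2 * k) * exp (- (gamma1 R * s))"
    "region_flow R k 7 s x = 2 * k - kj R + (x - (2 * k - kj R)) * exp (gamma2 R * s)"
    "region_flow R k 8 s x = kj R + (x - kj R) * exp (- (gamma3 R * s))"
    using eq[of 1 0] eq[of 3 "kj R"] eq[of 4 "2 * k - kj R"] eq[of 5 "2 * k"] eq[of 7 "2 * k - kj R"]
      eq[of 8 "kj R"]
    by (simp_all add: drift_def slope_def offset_def gamma4_def gamma5_def algebra_simps)
  show "region_flow R k 2 s x = x - gamma1 R * kc R * s"
    "region_flow R k 6 s x = x + gamma1 R * kc R * s"
    by (simp_all add: region_flow_def drift_def slope_def offset_def gamma4_def growth_def)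
qed

lemma has_mapI:
  assumes "valid_road R" "valid_signal S"
    and "\<And>x. region_flow R k j (green_time S) (region_flow R k i (green_time S) x) = F x"
  shows "has_map R S k i j F"
  unfolding has_map_def using combinationD(3)[OF assms(1,2)] assms(3) by simp

lemma has_fixed_pointsI:
  assumes "has_map R S k i j F" "\<And>x. F x = x \<longleftrightarrow> x \<in> X"
  shows "has_fixed_points R S k i j F X"
  using assms by (auto simp: has_fixed_points_def has_map_def stationary_def)

lemma exp_twice: "exp (- 2 * a * b) = (exp (- (a * b)))\<^sup>2" "exp (- (2 * a * b)) = (exp (- (a * b)))\<^sup>2" "exp (2 * a * b) = (exp (a * b))\<^sup>2"
  for a b :: real
  by (simp_all add: power2_eq_square algebra_simps flip: exp_add)

lemma exp_split: "exp ((a - b) * c) = exp (a * c) * exp (- (b * c))" for a b c :: real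
  by (simp add: algebra_simps flip: exp_add)

lemma affine_fixed_point: "a \<noteq> 1 \<Longrightarrow> b + x * a = x \<longleftrightarrow> x = b / (1 - a)" for a b x :: real
  by (auto simp: field_simps)

lemma factored_fixed_point:
  fixes a b c d x :: real
  assumes "c \<noteq> 0" "d \<noteq> 0" "y - x = c * (b - x * d)"
  shows "y = x \<longleftrightarrow> x = b / d"
  using assms by (auto simp: field_simps)

lemma map_1_5:
  fixes k :: real
  assumes R: "valid_road R" and S: "valid_signal S"
  defines "F \<equiv> \<lambda>x. 2 * k * (1 - exp (- gamma1 R * green_time S)) + x * exp (- 2 * gamma1 R * green_time S)"
  shows "has_map R S k 1 5 F"
    and "has_fixed_points R S k 1 5 F {2 * k / (1 + exp (- gamma1 R * green_time S))}"
proof -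
  show *: "has_map R S k 1 5 F"
    by (rule has_mapI[OF R S])
      (simp only: region_flow_closed_form[OF R] F_def gamma4_def gamma5_def exp_twice exp_split
        mult_minus_left power2_eq_square, simp add: algebra_simps)
  define e where "e = exp (- (gamma1 R * green_time S))"
  have e: "0 < e" "e < 1" using gamma_pos[OF R] valid_signalD[OF S] by (auto simp: e_def)
  show "has_fixed_points R S k 1 5 F {2 * k / (1 + exp (- gamma1 R * green_time S))}"
  proof (rule has_fixed_pointsI[OF *], unfold singleton_iff)
    show "F x = x \<longleftrightarrow> x = 2 * k / (1 + exp (- gamma1 R * green_time S))" for x
      by (rule factored_fixed_point[of "1 - e"])
        (simp_all only: F_def exp_twice mult_minus_left e_def[symmetric],
          use e in \<open>simp_all add: power2_eq_square algebra_simps\<close>)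
  qed
qed

text \<open>Region 1 contracts at rate \<open>gamma1 R\<close> and region 7 expands at rate \<open>gamma5 R\<close>. If the rates agree the
Poincare map is a translation, so a unique fixed point requires them to differ.\<close>

lemma map_1_7:
  fixes k :: real
  assumes R: "valid_road R" and S: "valid_signal S"
  defines "F \<equiv> \<lambda>x. (kj R - 2 * k) * (exp (gamma5 R * green_time S) - 1)
                   + x * exp ((gamma5 R - gamma1 R) * green_time S)"
  shows "has_map R S k 1 7 F"
    and "gamma5 R \<noteq> gamma1 R \<Longrightarrow> has_fixed_points R S k 1 7 F
      {(kj R - 2 * k) * (exp (gamma5 R * green_time S) - 1)
         / (1 - exp ((gamma5 R - gamma1 R) * green_time S))}"
proof -
  show *: "has_map R S k 1 7 F"
    by (rule has_mapI[OF R S])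
      (simp only: region_flow_closed_form[OF R] F_def gamma4_def gamma5_def exp_twice exp_split
        mult_minus_left power2_eq_square, simp add: algebra_simps)
  show "has_fixed_points R S k 1 7 F
      {(kj R - 2 * k) * (exp (gamma5 R * green_time S) - 1)
         / (1 - exp ((gamma5 R - gamma1 R) * green_time S))}" if "gamma5 R \<noteq> gamma1 R"
    unfolding F_def using that valid_signalD[OF S]
    by (intro has_fixed_pointsI *[unfolded F_def]) (auto intro: affine_fixed_point[THEN iffD1] simp: affine_fixed_point)
qed

lemma map_2_6:
  fixes k :: real
  assumes R: "valid_road R" and S: "valid_signal S"
  shows "has_map R S k 2 6 (\<lambda>x. x)" "has_fixed_points R S k 2 6 (\<lambda>x. x) UNIV"
proof -
  show *: "has_map R S k 2 6 (\<lambda>x. x)"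
    by (rule has_mapI[OF R S]) (simp add: region_flow_closed_form[OF R])
  show "has_fixed_points R S k 2 6 (\<lambda>x. x) UNIV"
    by (rule has_fixed_pointsI[OF *]) simp
qed

text \<open>Both flows have their equilibrium at \<open>2 * k - kj R\<close>, where ring 2 is jammed. The same happens for
\<open>(3, 8)\<close> below, where ring 1 is jammed. The fixed point is unique unless contraction and expansion
cancel.\<close>

lemma map_4_7:
  fixes k :: real
  assumes R: "valid_road R" and S: "valid_signal S"
  defines "F \<equiv> \<lambda>x. (kj R - 2 * k) * (exp ((gamma5 R - gamma3 R) * green_time S) - 1)
                   + x * exp ((gamma5 R - gamma3 R) * green_time S)"
  shows "has_map R S k 4 7 F"
    and "gamma5 R \<noteq> gamma3 R \<Longrightarrow> has_fixed_points R S k 4 7 F {2 * k - kj R}"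
proof -
  show *: "has_map R S k 4 7 F"
    by (rule has_mapI[OF R S])
      (simp only: region_flow_closed_form[OF R] F_def gamma4_def gamma5_def exp_twice exp_split
        mult_minus_left power2_eq_square, simp add: algebra_simps)
  show "has_fixed_points R S k 4 7 F {2 * k - kj R}" if ne: "gamma5 R \<noteq> gamma3 R"
  proof (rule has_fixed_pointsI[OF *], unfold singleton_iff)
    have "exp ((gamma5 R - gamma3 R) * green_time S) - 1 \<noteq> 0" using ne valid_signalD[OF S] by simp
    then show "F x = x \<longleftrightarrow> x = 2 * k - kj R" for x
      using factored_fixed_point[of "1 - exp ((gamma5 R - gamma3 R) * green_time S)" 1 "F x" x "2 * k - kj R"]
      by (simp add: F_def algebra_simps)
  qed
qed

text \<open>Mirror image of \<open>(1, 7)\<close> under exchange of the two rings and phases, with the same degenerate case.\<close>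

lemma map_3_5:
  fixes k :: real
  assumes R: "valid_road R" and S: "valid_signal S"
  defines "F \<equiv> \<lambda>x. kj R * (1 - exp (gamma2 R * green_time S)) * exp (- gamma4 R * green_time S)
                   + 2 * k * (1 - exp (- gamma4 R * green_time S))
                   + x * exp ((gamma2 R - gamma4 R) * green_time S)"
  shows "has_map R S k 3 5 F"
    and "gamma2 R \<noteq> gamma4 R \<Longrightarrow> has_fixed_points R S k 3 5 F
      {(2 * k * (1 - exp (- gamma4 R * green_time S))
          - kj R * (exp (gamma2 R * green_time S) - 1) * exp (- gamma4 R * green_time S))
         / (1 - exp ((gamma2 R - gamma4 R) * green_time S))}"
proof -
  show *: "has_map R S k 3 5 F"
    by (rule has_mapI[OF R S])
      (simp only: region_flow_closed_form[OF R] F_def gamma4_def gamma5_def exp_twice exp_split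
        mult_minus_left power2_eq_square, simp add: algebra_simps)
  show "has_fixed_points R S k 3 5 F
      {(2 * k * (1 - exp (- gamma4 R * green_time S))
          - kj R * (exp (gamma2 R * green_time S) - 1) * exp (- gamma4 R * green_time S))
         / (1 - exp ((gamma2 R - gamma4 R) * green_time S))}" if ne: "gamma2 R \<noteq> gamma4 R"
  proof (rule has_fixed_pointsI[OF *], unfold singleton_iff)
    have "1 - exp ((gamma2 R - gamma4 R) * green_time S) \<noteq> 0" using ne valid_signalD[OF S] by simp
    then show "F x = x \<longleftrightarrow> x = (2 * k * (1 - exp (- gamma4 R * green_time S))
          - kj R * (exp (gamma2 R * green_time S) - 1) * exp (- gamma4 R * green_time S))
         / (1 - exp ((gamma2 R - gamma4 R) * green_time S))" for x
      by (intro factored_fixed_point[of 1]) (simp_all add: F_def algebra_simps)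
  qed
qed

lemma map_3_7:
  fixes k :: real
  assumes R: "valid_road R" and S: "valid_signal S"
  defines "F \<equiv> \<lambda>x. kj R * (2 * exp (gamma2 R * green_time S) - exp (2 * gamma2 R * green_time S) - 1)
                   - 2 * k * (exp (gamma2 R * green_time S) - 1)
                   + x * exp (2 * gamma2 R * green_time S)"
  shows "has_map R S k 3 7 F"
    and "has_fixed_points R S k 3 7 F
      {(2 * k + kj R * (exp (gamma2 R * green_time S) - 1)) / (exp (gamma2 R * green_time S) + 1)}"
proof -
  show *: "has_map R S k 3 7 F"
    by (rule has_mapI[OF R S])
      (simp only: region_flow_closed_form[OF R] F_def gamma4_def gamma5_def exp_twice exp_split
        mult_minus_left power2_eq_square, simp add: algebra_simps)
  define e where "e = exp (gamma2 R * green_time S)"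
  have e: "1 < e" using gamma_pos[OF R] valid_signalD[OF S] by (auto simp: e_def)
  show "has_fixed_points R S k 3 7 F
      {(2 * k + kj R * (exp (gamma2 R * green_time S) - 1)) / (exp (gamma2 R * green_time S) + 1)}"
  proof (rule has_fixed_pointsI[OF *], unfold singleton_iff)
    show "F x = x \<longleftrightarrow>
      x = (2 * k + kj R * (exp (gamma2 R * green_time S) - 1)) / (exp (gamma2 R * green_time S) + 1)" for x
      by (rule factored_fixed_point[of "1 - e"])
        (simp_all only: F_def exp_twice mult_minus_left e_def[symmetric],
          use e in \<open>simp_all add: power2_eq_square algebra_simps\<close>)
  qed
qed

lemma map_3_8:
  fixes k :: real
  assumes R: "valid_road R" and S: "valid_signal S"
  defines "F \<equiv> \<lambda>x. kj R * (1 - exp ((gamma2 R - gamma3 R) * green_time S))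
                   + x * exp ((gamma2 R - gamma3 R) * green_time S)"
  shows "has_map R S k 3 8 F"
    and "gamma2 R \<noteq> gamma3 R \<Longrightarrow> has_fixed_points R S k 3 8 F {kj R}"
proof -
  show *: "has_map R S k 3 8 F"
    by (rule has_mapI[OF R S])
      (simp only: region_flow_closed_form[OF R] F_def gamma4_def gamma5_def exp_twice exp_split
        mult_minus_left power2_eq_square, simp add: algebra_simps)
  show "has_fixed_points R S k 3 8 F {kj R}" if ne: "gamma2 R \<noteq> gamma3 R"
  proof (rule has_fixed_pointsI[OF *], unfold singleton_iff)
    have "exp ((gamma2 R - gamma3 R) * green_time S) - 1 \<noteq> 0" using ne valid_signalD[OF S] by simp
    then show "F x = x \<longleftrightarrow> x = kj R" for x
      using factored_fixed_point[of "1 - exp ((gamma2 R - gamma3 R) * green_time S)" 1 "F x" x "kj R"]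
      by (simp add: F_def algebra_simps)
  qed
qed

lemma map_4_8:
  fixes k :: real
  assumes R: "valid_road R" and S: "valid_signal S"
  defines "F \<equiv> \<lambda>x. kj R * (exp (- 2 * gamma3 R * green_time S) - 2 * exp (- gamma3 R * green_time S) + 1)
                   - 2 * k * (exp (- 2 * gamma3 R * green_time S) - exp (- gamma3 R * green_time S))
                   + x * exp (- 2 * gamma3 R * green_time S)"
  shows "has_map R S k 4 8 F"
    and "has_fixed_points R S k 4 8 F
      {(kj R * (1 - exp (- gamma3 R * green_time S)) + 2 * k * exp (- gamma3 R * green_time S))
         / (1 + exp (- gamma3 R * green_time S))}"
proof -
  show *: "has_map R S k 4 8 F"
    by (rule has_mapI[OF R S])
      (simp only: region_flow_closed_form[OF R] F_def gamma4_def gamma5_def exp_twice exp_split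
        mult_minus_left power2_eq_square, simp add: algebra_simps)
  define e where "e = exp (- (gamma3 R * green_time S))"
  have e: "0 < e" "e < 1" using gamma_pos[OF R] valid_signalD[OF S] by (auto simp: e_def)
  show "has_fixed_points R S k 4 8 F
      {(kj R * (1 - exp (- gamma3 R * green_time S)) + 2 * k * exp (- gamma3 R * green_time S))
         / (1 + exp (- gamma3 R * green_time S))}"
  proof (rule has_fixed_pointsI[OF *], unfold singleton_iff)
    show "F x = x \<longleftrightarrow>
      x = (kj R * (1 - exp (- gamma3 R * green_time S)) + 2 * k * exp (- gamma3 R * green_time S))
         / (1 + exp (- gamma3 R * green_time S))" for x
      by (rule factored_fixed_point[of "1 - e"])
        (simp_all only: F_def exp_twice mult_minus_left e_def[symmetric],
          use e in \<open>simp_all add: power2_eq_square algebra_simps\<close>)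
  qed
qed

lemma gamma2_eq_gamma3_iff:
  assumes "valid_road R" shows "gamma2 R = gamma3 R \<longleftrightarrow> xi R = 1 / 2"
proof -
  have "gamma2 R = gamma3 R \<longleftrightarrow> (1 - xi R) / xi R = 1"
    unfolding gamma_ratios(2)[OF assms] mult_cancel_left2 using gamma_pos[OF assms] by auto
  also have "\<dots> \<longleftrightarrow> xi R = 1 / 2" using valid_roadD[OF assms] by (auto simp: field_simps)
  finally show ?thesis .
qed

section \<open>Balance of the two phases in a stationary state\<close>

lemma rate_one_nonpos:
  assumes "valid_road R" "z \<in> {0..kj R}" "2 * k - z \<in> {0..kj R}"
  shows "rate_one R k z \<le> 0"
  unfolding rate_normal_form[OF assms(1)]
  using valid_roadD[OF assms(1)] gamma_pos[OF assms(1)] assms(2,3)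
  by (auto intro!: mult_nonneg_nonneg)

text \<open>Equal durations of the two phases force equal speeds somewhere. The alternative in the conclusion
separates an orbit that stands still from a moving one; for a moving orbit the balance is attained
strictly between the extreme densities, so that inequalities of both regions hold on both sides of
it. This excludes coincidences on a boundary.\<close>

lemma balance_point:
  assumes R: "valid_road R" and S: "valid_signal S" and x: "x \<in> stationary R S k i j"
  obtains z where "drift R k i z + drift R k j z = 0" "(z, k) \<in> region R i \<inter> region R j"
    "z = x \<and> drift R k i z = 0 \<or>
     (\<exists>a b. a < z \<and> z < b \<and> (\<forall>w\<in>{a..b}. (w, k) \<in> region R i \<inter> region R j))"
proof -
  define g where "g = green_time S"
  define y where "y = region_flow R k i g x"
  have xc: "x \<in> combination R S k i j" and fix_x: "poincare R S k x = x"
    using x by (auto simp: stationary_def)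
  note c = combinationD[OF R S xc, folded g_def, folded y_def]
  have g: "0 < g" using valid_signalD[OF S] by (simp add: g_def)
  have x_eq: "region_flow R k j g y = x" using c(3) fix_x by simp
  have gr: "0 < growth A s" if "0 < s" for A s using growth_strict_mono[OF that, of A] by simp
  have xi: "(x, k) \<in> region R i" and yj: "(y, k) \<in> region R j"
    using c(4)[of 0] c(5)[of 0] g by auto
  show thesis
  proof (cases "drift R k i x = 0")
    case True
    then have "y = x" by (simp add: y_def region_flow_def)
    then have "drift R k j x = 0" using x_eq gr[OF g, of "slope R j"] by (simp add: region_flow_def)
    then show thesis using that[of x] True xi yj \<open>y = x\<close> by auto
  next
    case False
    have "drift R k i x \<le> 0"
      using rate_one_nonpos[OF R region_range[OF R xi]] rate_one_in_region[OF R c(1) xi] by simp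
    with False have D: "drift R k i x < 0" by simp
    have between: "y < region_flow R k i s x" "region_flow R k i s x < x" if "0 < s" "s < g" for s
      using D gr[OF that(1)] growth_strict_mono[OF that(2)]
      by (auto simp: y_def region_flow_def mult_neg_pos)
    have in_both: "(w, k) \<in> region R i \<inter> region R j" if w: "y < w" "w < x" for w
    proof -
      obtain s where "0 \<le> s" "s \<le> g" "region_flow R k i s x = w"
        using IVT2'[of "\<lambda>s. region_flow R k i s x" g w 0] w g region_flow_continuous
        by (auto simp: y_def[symmetric])
      moreover have "s \<noteq> g" using w calculation by (auto simp: y_def)
      moreover obtain t where "0 \<le> t" "t \<le> g" "region_flow R k j t y = w"
        using IVT'[of "\<lambda>s. region_flow R k j s y" 0 w g] w g region_flow_continuous
        by (auto simp: x_eq)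
      moreover have "t \<noteq> g" using w calculation by (auto simp: x_eq)
      ultimately show ?thesis using c(4)[of s] c(5)[of t] by auto
    qed
    \<comment> \<open>\<open>\<phi>\<close> is phase one run backwards, so \<open>h\<close> and \<open>\<phi>\<close> both climb from \<open>y\<close> to \<open>x\<close> in time \<open>g\<close>. The
      integrating factor of region \<open>j\<close> removes \<open>h\<close> from the derivative of their weighted difference
      \<open>E\<close>, leaving, up to that factor, the sum of the two drifts at \<open>\<phi> s\<close>.\<close>
    define \<phi> where "\<phi> s = region_flow R k i (g - s) x" for s
    define h where "h s = region_flow R k j s y" for s
    define E where "E s = exp (- (slope R j * s)) * (h s - \<phi> s)" for s
    have der_\<phi>: "(\<phi> has_real_derivative - drift R k i (\<phi> s)) (at s)" for s
    proof -
      have "((\<lambda>s. g - s) has_real_derivative - 1) (at s)" by (auto intro!: derivative_eq_intros)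
      from DERIV_chain2[OF region_flow_deriv this] show ?thesis unfolding \<phi>_def by simp
    qed
    have der_h: "(h has_real_derivative drift R k j (h s)) (at s)" for s
      unfolding h_def by (rule region_flow_deriv)
    have split: "drift R k j (h s) = drift R k j (\<phi> s) + slope R j * (h s - \<phi> s)" for s
      using drift_diff[of R k j "h s" "\<phi> s"] by simp
    have der: "(E has_real_derivative exp (- (slope R j * s)) * (drift R k i (\<phi> s) + drift R k j (\<phi> s))) (at s)"
      for s unfolding E_def
      by (rule derivative_eq_intros der_\<phi> der_h refl)+
        (simp add: split algebra_simps)
    have ends: "E 0 = E g" by (simp add: E_def \<phi>_def h_def x_eq flip: y_def)
    have cont: "continuous_on {0..g} E"
      by (rule DERIV_continuous_on[OF has_field_derivative_at_within[OF der]])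
    obtain s where s: "0 < s" "s < g"
      and "(*) (exp (- (slope R j * s)) * (drift R k i (\<phi> s) + drift R k j (\<phi> s))) = (\<lambda>v. 0)"
      using Rolle_deriv[OF g ends cont der[unfolded has_field_derivative_def]] by blast
    from fun_cong[OF this(3), of 1] have zero: "drift R k i (\<phi> s) + drift R k j (\<phi> s) = 0" by simp
    have z: "y < \<phi> s" "\<phi> s < x" unfolding \<phi>_def using between[of "g - s"] s by auto
    show thesis
    proof (rule that[OF zero in_both[OF z]])
      have "(y + \<phi> s) / 2 < \<phi> s" "\<phi> s < (\<phi> s + x) / 2" using z by auto
      moreover have "\<forall>w\<in>{(y + \<phi> s) / 2..(\<phi> s + x) / 2}. (w, k) \<in> region R i \<inter> region R j"
      proof
        fix w assume "w \<in> {(y + \<phi> s) / 2..(\<phi> s + x) / 2}"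
        then show "(w, k) \<in> region R i \<inter> region R j" using z by (intro in_both) auto
      qed
      ultimately show "\<phi> s = x \<and> drift R k i (\<phi> s) = 0 \<or>
        (\<exists>a b. a < \<phi> s \<and> \<phi> s < b \<and> (\<forall>w\<in>{a..b}. (w, k) \<in> region R i \<inter> region R j))" by blast
    qed
  qed
qed

text \<open>Each pair of regions is tested at a balance point. Strict inequalities of a region, or weak ones on
both sides of the balance point, exclude most pairs. For \<open>(1, 7)\<close> and \<open>(3, 5)\<close> the balance says that
a ratio \<open>\<rho>\<close> does not exceed 1, i.e. \<open>xi R \<ge> 1 / 2\<close>; the value \<open>\<rho> = 1\<close> puts the balance point on the
boundary line of a region, and a moving orbit is possible only if it slides along this line. An
orbit standing still in \<open>(3, 5)\<close> has ring 1 jammed and ring 2 empty.\<close>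

lemma stationary_cases:
  assumes R: "valid_road R" and S: "valid_signal S" and x: "x \<in> stationary R S k i j"
  shows "(i, j) \<in> {(1, 5), (2, 6), (4, 7), (3, 8)} \<or>
    (i, j) = (1, 7) \<and> (1 / 2 < xi R \<or> xi R = 1 / 2 \<and> kj R = 3 * kc R \<and> k = kj R / 2) \<or>
    (i, j) = (3, 5) \<and> (1 / 2 < xi R \<or> x = kj R \<and> k = kj R / 2 \<or>
       xi R = 1 / 2 \<and> kj R = 3 * kc R \<and> k = kj R / 2) \<or>
    (i, j) = (3, 7) \<and> 1 / 2 < xi R \<or>
    (i, j) = (4, 8) \<and> xi R < 1 / 2"
proof -
  note v = valid_roadD[OF R]
  \<comment> \<open>In units of \<open>gamma3 R\<close>, \<open>m\<close> is the flow at capacity and \<open>\<rho>\<close> the weight of a vacancy in the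
    own ring relative to one in the other ring; \<open>q\<close> below is the density of ring 2.\<close>
  define m where "m = (1 - xi R) * (kj R - kc R)"
  define \<rho> where "\<rho> = (1 - xi R) / xi R"
  have m: "0 < m" "m < kj R - kc R" using v by (auto simp: m_def)
  have \<rho>: "0 < \<rho>" "\<rho> * (xi R * (kj R - kc R)) = m" using v by (auto simp: \<rho>_def m_def)
  have \<rho>_1: "1 / 2 < xi R \<or> xi R = 1 / 2" if "\<rho> \<le> 1"
    using that v by (simp add: \<rho>_def divide_le_eq_1_pos) linarith
  have half: "\<rho> = 1" "m = (kj R - kc R) / 2" if "xi R = 1 / 2" using that by (auto simp: \<rho>_def m_def)
  note reg = region_iff[OF R, folded m_def]
  note d = drift_normal_form[OF R, folded m_def \<rho>_def]
  obtain z where bal: "drift R k i z + drift R k j z = 0"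
    and z: "(z, k) \<in> region R i \<inter> region R j"
    and alt: "z = x \<and> drift R k i z = 0 \<or>
      (\<exists>a b. a < z \<and> z < b \<and> (\<forall>w\<in>{a..b}. (w, k) \<in> region R i \<inter> region R j))"
    by (rule balance_point[OF R S x])
  have zi: "(z, k) \<in> region R i" and zj: "(z, k) \<in> region R j" using z by auto
  have moving: concl
    if ne: "\<not> (z = x \<and> drift R k i z = 0)"
      and concl: "\<And>a b. a < z \<Longrightarrow> z < b \<Longrightarrow> (a, k) \<in> region R i \<Longrightarrow> (b, k) \<in> region R i \<Longrightarrow>
        (a, k) \<in> region R j \<Longrightarrow> (b, k) \<in> region R j \<Longrightarrow> concl" for concl
  proof -
    obtain a b where ab: "a < z" "z < b" "\<forall>w\<in>{a..b}. (w, k) \<in> region R i \<inter> region R j"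
      using alt ne by blast
    then have "a \<in> {a..b}" "b \<in> {a..b}" by auto
    with ab show concl using concl by blast
  qed
  define q where "q = 2 * k - z"
  have eq: "p = p'" if "- gamma3 R * p + gamma3 R * p' = 0" for p p'
    using that gamma_pos[OF R] by simp
  have dem: "m / kc R * p = r \<longleftrightarrow> m * p = kc R * r" for p r using v by (auto simp: field_simps)
  \<comment> \<open>Two boundary inequalities with equality in between can hold only if the slopes agree.\<close>
  have cancel: "m = kc R" if "m * s \<le> kc R * s" "kc R * t \<le> m * t" "0 < s" "0 < t" for s t
    using that by simp
  have "i \<in> {1, 2, 3, 4}" "j \<in> {5, 6, 7, 8}"
    using x by (auto simp: stationary_def combination_def)
  then have "(i, j) \<in> {(1, 5), (2, 6), (4, 7), (3, 8)} \<or>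
    i = 1 \<and> j = 6 \<or> i = 1 \<and> j = 8 \<or> i = 2 \<and> j = 5 \<or> i = 2 \<and> j = 7 \<or> i = 2 \<and> j = 8 \<or> i = 3 \<and> j = 6 \<or>
    i = 4 \<and> j = 5 \<or> i = 4 \<and> j = 6 \<or> i = 4 \<and> j = 8 \<or> i = 1 \<and> j = 7 \<or> i = 3 \<and> j = 5 \<or> i = 3 \<and> j = 7"
    by auto
  then show ?thesis
  proof (elim disjE conjE)
    assume "(i, j) \<in> {(1, 5), (2, 6), (4, 7), (3, 8)}"
    then show ?thesis by blast
  next
    assume 2: "i = 1" "j = 6"
    have "m / kc R * z = m" using eq bal[unfolded 2 d] by blast
    then have "m * z = kc R * m" using dem by blast
    then have "z = kc R" using m by (simp add: mult.commute[of "kc R"])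
    then show ?thesis using m zi[unfolded 2 reg] by simp
  next
    assume 3: "i = 1" "j = 8"
    then show ?thesis using m zi[unfolded 3 reg] zj[unfolded 3 reg] by linarith
  next
    assume 4: "i = 2" "j = 5"
    have "m / kc R * q = m" using eq bal[unfolded 4 d] unfolding q_def by metis
    then have "m * q = kc R * m" using dem by blast
    then have "q = kc R" using m by (simp add: mult.commute[of "kc R"])
    have "drift R k 2 z \<noteq> 0" unfolding d using gamma_pos(3)[OF R] m by simp
    then obtain a where "a < z" "(a, k) \<in> region R 5" using moving unfolding 4 by blast
    then show ?thesis using \<open>q = kc R\<close> unfolding reg q_def by simp
  next
    assume 5: "i = 2" "j = 7"
    have "m = \<rho> * (kj R - q)" using eq bal[unfolded 5 d] unfolding q_def by blast
    also have "\<dots> < \<rho> * (xi R * (kj R - kc R))"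
      using \<rho>(1) zj[unfolded 5 reg, folded q_def] by (intro mult_strict_left_mono) auto
    finally show ?thesis using \<rho> by simp
  next
    assume 6: "i = 2" "j = 8"
    have "m = kj R - z" using eq bal[unfolded 6 d] by blast
    then show ?thesis using zj[unfolded 6 reg] by simp
  next
    assume 7: "i = 3" "j = 6"
    have e: "\<rho> * (kj R - z) = m" using eq bal[unfolded 7 d] by blast
    have "drift R k 3 z \<noteq> 0" unfolding d e using gamma_pos(3)[OF R] m by simp
    then obtain a where a: "a < z" "(a, k) \<in> region R 3" using moving unfolding 7 by blast
    have "\<rho> * (kj R - a) \<le> \<rho> * (xi R * (kj R - kc R))" 
      using a(2)[unfolded reg] \<rho>(1) by (intro mult_left_mono) auto
    also have "\<dots> = \<rho> * (kj R - z)" using e \<rho> by simp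
    finally show ?thesis using a(1) \<rho>(1) by simp
  next
    assume 8: "i = 4" "j = 5"
    then show ?thesis using m zi[unfolded 8 reg] zj[unfolded 8 reg] by linarith
  next
    assume 9: "i = 4" "j = 6"
    have "kj R - q = m" using eq bal[unfolded 9 d] unfolding q_def by blast
    then show ?thesis using zi[unfolded 9 reg, folded q_def] by simp
  next
    assume 10: "i = 4" "j = 8"
    have e: "kj R - q = kj R - z" using eq bal[unfolded 10 d] unfolding q_def by blast
    have "xi R * (kj R - z) < (1 - xi R) * (kj R - z)" "z < kj R"
      using zi[unfolded 10 reg, folded q_def] e by simp_all
    then have "xi R < 1 / 2" by simp
    then show ?thesis using 10 by simp
  next
    assume 11: "i = 1" "j = 7"
    have e: "m * z = kc R * (\<rho> * (kj R - q))" using eq bal[unfolded 11 d] dem unfolding q_def by blast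
    have zq: "0 < z" "m * z \<le> kc R * (kj R - q)" using zi[unfolded 11 reg, folded q_def] by auto
    then have "0 < m * z" using m by simp
    with zq(2) have "0 < kc R * (kj R - q)" by linarith
    then have "0 < kj R - q" by (rule zero_less_mult_pos) (rule v(3))
    moreover have "kc R * (\<rho> * (kj R - q)) \<le> kc R * (kj R - q)" using e zq(2) by linarith
    then have "\<rho> * (kj R - q) \<le> 1 * (kj R - q)"
      unfolding mult_1 by (rule mult_left_le_imp_le) (rule v(3))
    ultimately have "\<rho> \<le> 1" by (simp only: mult_le_cancel_right_pos)
    moreover have "kj R = 3 * kc R \<and> k = kj R / 2" if xi: "xi R = 1 / 2"
    proof -
      have e': "m * z = kc R * (kj R - q)" using e half(1)[OF xi] by simp
      have "drift R k 1 z \<noteq> 0" unfolding d using gamma_pos(3)[OF R] \<open>0 < z\<close> m v(3) by simp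
      then obtain a b where ab: "a < z" "z < b" "(a, k) \<in> region R 1" "(b, k) \<in> region R 1"
        using moving unfolding 11 by blast
      have "m * a \<le> kc R * (kj R - (2 * k - a))" "m * b \<le> kc R * (kj R - (2 * k - b))"
        using ab(3,4) unfolding reg by auto
      then have "kc R * (z - a) \<le> m * (z - a)" "m * (b - z) \<le> kc R * (b - z)"
        using e' unfolding q_def by (simp_all add: algebra_simps)
      then have mk: "m = kc R" using cancel ab by simp
      then have "kj R = 3 * kc R" using half(2)[OF xi] by simp
      moreover have "z = kj R - q" using e' mk v(3) by simp
      ultimately show ?thesis by (simp add: q_def)
    qed
    ultimately show ?thesis using \<rho>_1 11 by blast
  next
    assume 12: "i = 3" "j = 5"
    have "m / kc R * q = \<rho> * (kj R - z)" using eq bal[unfolded 12 d] unfolding q_def by metis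
    then have e: "m * q = kc R * (\<rho> * (kj R - z))" using dem by blast
    have zq: "z \<le> kj R" "m * q \<le> kc R * (kj R - z)" using zj[unfolded 12 reg, folded q_def] by auto
    show ?thesis
    proof (cases "z = kj R")
      case True
      have "q = 0" using e m True by simp
      moreover have "x = kj R" 
      proof (rule ccontr)
        assume "x \<noteq> kj R"
        then obtain b where "z < b" "(b, k) \<in> region R 3" using moving True unfolding 12 by metis
        then show False using True unfolding reg by simp
      qed
      ultimately show ?thesis using 12 True by (simp add: q_def)
    next
      case False
      have "kc R * (\<rho> * (kj R - z)) \<le> kc R * (kj R - z)" using e zq(2) by linarith
      then have "\<rho> * (kj R - z) \<le> 1 * (kj R - z)"
        unfolding mult_1 by (rule mult_left_le_imp_le) (rule v(3))
      moreover have "0 < kj R - z" using False zq(1) by simp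
      ultimately have "\<rho> \<le> 1" by (simp only: mult_le_cancel_right_pos)
      moreover have "kj R = 3 * kc R \<and> k = kj R / 2" if xi: "xi R = 1 / 2"
      proof -
        have e': "m * q = kc R * (kj R - z)" using e half(1)[OF xi] by simp
        have "drift R k 3 z \<noteq> 0" unfolding d using gamma_pos(3)[OF R] False \<rho>(1) by simp
        then obtain a b where ab: "a < z" "z < b" "(a, k) \<in> region R 5" "(b, k) \<in> region R 5"
          using moving unfolding 12 by blast
        have "m * (2 * k - a) \<le> kc R * (kj R - a)" "m * (2 * k - b) \<le> kc R * (kj R - b)"
          using ab(3,4) unfolding reg by auto
        then have "m * (z - a) \<le> kc R * (z - a)" "kc R * (b - z) \<le> m * (b - z)"
          using e' unfolding q_def by (simp_all add: algebra_simps)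
        then have mk: "m = kc R" using cancel ab by simp
        then have "kj R = 3 * kc R" using half(2)[OF xi] by simp
        moreover have "q = kj R - z" using e' mk v(3) by simp
        ultimately show ?thesis by (simp add: q_def)
      qed
      ultimately show ?thesis using \<rho>_1 12 by blast
    qed
  next
    assume 13: "i = 3" "j = 7"
    have "\<rho> * (kj R - z) = \<rho> * (kj R - q)" using eq bal[unfolded 13 d] unfolding q_def by blast
    then have e: "q = z" using \<rho> by simp
    have "(1 - xi R) * (kj R - z) < xi R * (kj R - z)" "z \<le> kj R"
      using zj[unfolded 13 reg, folded q_def] e by simp_all
    then have "1 / 2 < xi R" by (cases "z = kj R") simp_all
    then show ?thesis using 13 by simp
  qed
qed

section \<open>Existence of stationary states\<close>

text \<open>For fixed \<open>k\<close> all defining inequalities are affine in the density of ring 1, hence a region is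
convex in this direction. Only the inequalities comparing a demand with a supply have a coefficient
of undetermined sign, namely \<open>m - kc R\<close>.\<close>

lemma region_interval:
  assumes R: "valid_road R" and ab: "(a, k) \<in> region R i" "(b, k) \<in> region R i" "a \<le> z" "z \<le> b"
  shows "(z, k) \<in> region R i"
proof -
  define m where "m = (1 - xi R) * (kj R - kc R)"
  note reg = region_iff[OF R, folded m_def]
  have "(m - kc R) * a \<le> (m - kc R) * z \<and> (m - kc R) * z \<le> (m - kc R) * b \<or>
    (m - kc R) * b \<le> (m - kc R) * z \<and> (m - kc R) * z \<le> (m - kc R) * a"
    using ab(3,4) by (metis mult_left_mono mult_left_mono_neg linear diff_ge_0_iff_ge diff_le_0_iff_le)
  then have p: "m * a - kc R * a \<le> m * z - kc R * z \<and> m * z - kc R * z \<le> m * b - kc R * b \<or>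
    m * b - kc R * b \<le> m * z - kc R * z \<and> m * z - kc R * z \<le> m * a - kc R * a"
    by (simp add: left_diff_distrib)
  have "i \<in> {1, 2, 3, 4, 5, 6, 7, 8}" using ab(1) by (auto simp: region_def split: if_splits)
  then consider "i = 1" | "i = 2" | "i = 3" | "i = 4" | "i = 5" | "i = 6" | "i = 7" | "i = 8" by blast
  then show ?thesis
    using ab p
    by cases (simp_all only: reg right_diff_distrib left_diff_distrib mult_1,
      (elim disjE conjE; intro conjI; linarith)+)
qed

text \<open>The flow is monotone in time; the sign of the drift decides which of the two alternatives holds.\<close>

lemma region_flow_between:
  assumes "0 \<le> s" "s \<le> g"
  shows "x \<le> region_flow R k i s x \<and> region_flow R k i s x \<le> region_flow R k i g x \<or>
    region_flow R k i g x \<le> region_flow R k i s x \<and> region_flow R k i s x \<le> x"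
proof -
  have "0 \<le> growth (slope R i) s" "growth (slope R i) s \<le> growth (slope R i) g"
    using growth_strict_mono[of 0 s "slope R i"] growth_strict_mono[of s g "slope R i"] assms
    by (auto simp: le_less)
  then show ?thesis
    unfolding region_flow_def
    by (cases "0 \<le> drift R k i x") (simp_all add: mult_left_mono mult_left_mono_neg mult_nonpos_nonneg)
qed

text \<open>The two flows between \<open>x\<close> and \<open>y\<close> are repeated with period \<open>2 * g\<close>, for a signal without lost time.
Only the end points have to be located in the regions: the flow is monotone and a region is an
interval. The case \<open>x = y\<close> is an orbit that stands still.\<close>

lemma can_have_stationaryI:
  assumes R: "valid_road R" and ij: "i \<in> {1, 2, 3, 4}" "j \<in> {5, 6, 7, 8}" and g: "0 < g"
    and y: "region_flow R k i g x = y" and x: "region_flow R k j g y = x" and "y \<le> x"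
    and reg: "(x, k) \<in> region R i" "(y, k) \<in> region R i" "(x, k) \<in> region R j" "(y, k) \<in> region R j"
  shows "can_have_stationary R i j"
proof -
  define S where "S = \<lparr>cyc = 2 * g, lost = 0, green = 1 / 2\<rparr>"
  have S: "valid_signal S" "green_time S = g" "cyc S = 2 * g" "lost S = 0"
    using g by (auto simp: S_def valid_signal_def green_time_def)
  define u where "u t = (let s = t - 2 * g * of_int \<lfloor>t / (2 * g)\<rfloor> in
    if s < g then region_flow R k i s x else region_flow R k j (s - g) y)" for t
  have u_cycle: "u (real n * (2 * g) + s) = (if s < g then region_flow R k i s x else region_flow R k j (s - g) y)"
    if "0 \<le> s" "s < 2 * g" for n :: nat and s
  proof -
    have "\<lfloor>(real n * (2 * g) + s) / (2 * g)\<rfloor> = int n"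
      using that g by (intro floor_unique) (simp_all add: field_simps)
    then show ?thesis by (simp add: u_def Let_def mult.commute)
  qed
  have one: "u (real n * (2 * g) + s) = region_flow R k i s x" if "0 \<le> s" "s \<le> g" for n :: nat and s
    using u_cycle[of s n] that g y by (cases "s = g") auto
  have two: "u (real n * (2 * g) + g + s) = region_flow R k j s y" if "0 \<le> s" "s \<le> g" for n :: nat and s
  proof (cases "s = g")
    case True
    then show ?thesis using one[of 0 "Suc n"] g x by (simp add: algebra_simps)
  next
    case False
    then show ?thesis using u_cycle[of "g + s" n] that by (simp add: add.assoc)
  qed
  have range1: "y \<le> region_flow R k i s x" "region_flow R k i s x \<le> x" if "0 \<le> s" "s \<le> g" for s
    using region_flow_between[OF that, of x R k i] y \<open>y \<le> x\<close> by auto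
  have range2: "y \<le> region_flow R k j s y" "region_flow R k j s y \<le> x" if "0 \<le> s" "s \<le> g" for s
    using region_flow_between[OF that, of y R k j] x \<open>y \<le> x\<close> by auto
  have u_range: "y \<le> u t" "u t \<le> x" if t: "0 \<le> t" for t
  proof -
    define n where "n = nat \<lfloor>t / (2 * g)\<rfloor>"
    define s where "s = t - real n * (2 * g)"
    have n: "real n \<le> t / (2 * g)" "t / (2 * g) < real n + 1"
      using t g by (simp_all add: n_def of_nat_nat)
    then have s: "0 \<le> s" "s < 2 * g" "t = real n * (2 * g) + s"
      using g by (simp_all add: s_def field_simps)
    show "y \<le> u t" "u t \<le> x"
      using u_cycle[OF s(1,2), of n] range1[of s] range2[of "s - g"] s by auto
  qed
  have piece: "continuous_on {a..a + g} u"
      "\<forall>t\<in>{a..<a + g}. (u has_real_derivative drift R k l (u t)) (at t within {a..<a + g})"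
    if eq: "\<And>s. 0 \<le> s \<Longrightarrow> s \<le> g \<Longrightarrow> u (a + s) = region_flow R k l s w" for a l w
  proof -
    have u_eq: "u t = region_flow R k l (t - a) w" if "t \<in> {a..a + g}" for t
      using eq[of "t - a"] that by simp
    have der: "((\<lambda>t. region_flow R k l (t - a) w) has_real_derivative drift R k l (region_flow R k l (t - a) w))
       (at t within X)" for t X
    proof -
      have "((\<lambda>t. t - a) has_real_derivative 1) (at t within X)" by (auto intro!: derivative_eq_intros)
      from DERIV_chain2[OF region_flow_deriv this] show ?thesis by simp
    qed
    have "continuous_on {a..a + g} (\<lambda>t. region_flow R k l (t - a) w)"
      by (rule DERIV_continuous_on[OF der])
    moreover have "continuous_on {a..a + g} u \<longleftrightarrow> continuous_on {a..a + g} (\<lambda>t. region_flow R k l (t - a) w)"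
      by (rule continuous_on_cong[OF refl]) (rule u_eq)
    ultimately show "continuous_on {a..a + g} u" by simp
    show "\<forall>t\<in>{a..<a + g}. (u has_real_derivative drift R k l (u t)) (at t within {a..<a + g})"
    proof
      fix t assume t: "t \<in> {a..<a + g}"
      then have "drift R k l (region_flow R k l (t - a) w) = drift R k l (u t)" using u_eq by simp
      with der[of t "{a..<a + g}"]
      have "((\<lambda>t. region_flow R k l (t - a) w) has_real_derivative drift R k l (u t)) (at t within {a..<a + g})"
        by simp
      then show "(u has_real_derivative drift R k l (u t)) (at t within {a..<a + g})"
        by (rule has_field_derivative_transform_within[OF _ zero_less_one t]) (simp add: u_eq)
    qed
  qed
  \<comment> \<open>Continuity on the half-line is local, so it suffices to glue the closed phases of the
    first \<open>n\<close> cycles.\<close>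
  have upto: "continuous_on {0..real n * (2 * g)} u" for n
  proof (induction n)
    case (Suc n)
    have "continuous_on ({0..real n * (2 * g)} \<union> {real n * (2 * g)..real n * (2 * g) + g} \<union>
        {real n * (2 * g) + g..real n * (2 * g) + g + g}) u"
      by (intro continuous_on_closed_Un closed_Un closed_atLeastAtMost Suc piece(1)[OF one] piece(1)[OF two])
    moreover have "0 \<le> real n * (2 * g)" "real (Suc n) * (2 * g) = real n * (2 * g) + g + g"
      using g by (simp_all add: algebra_simps)
    then have "{0..real (Suc n) * (2 * g)} = {0..real n * (2 * g)} \<union>
        {real n * (2 * g)..real n * (2 * g) + g} \<union> {real n * (2 * g) + g..real n * (2 * g) + g + g}"
      using g by (auto simp only: Un_iff atLeastAtMost_iff set_eq_iff)
    ultimately show ?case by simp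
  qed simp
  have cont: "continuous_on {0..} u"
    unfolding continuous_on_eq_continuous_within
  proof
    fix t :: real assume t: "t \<in> {0..}"
    obtain n :: nat where "t / (2 * g) < real n" using reals_Archimedean2 by blast
    then have tn: "t < real n * (2 * g)" using g by (simp add: field_simps)
    have "at t within {0..} = at t within {0..real n * (2 * g)}"
      by (rule at_within_nhd[of t "{..<real n * (2 * g)}"]) (use tn in auto)
    moreover have "continuous (at t within {0..real n * (2 * g)}) u"
      using upto[of n] tn t unfolding continuous_on_eq_continuous_within by auto
    ultimately show "continuous (at t within {0..}) u" by simp
  qed
  have in_i: "(u t, k) \<in> region R i" and in_j: "(u t, k) \<in> region R j" if "0 \<le> t" for t
    using region_interval[OF R reg(2,1) u_range[OF that]] region_interval[OF R reg(4,3) u_range[OF that]]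
    by auto
  have sets: "phase_one S n = {real n * (2 * g)..<real n * (2 * g) + g}"
    "phase_two S n = {real n * (2 * g) + g..<real n * (2 * g) + g + g}"
    "lost_one S n = {}" "lost_two S n = {}" for n
    using S by (auto simp: phase_one_def phase_two_def lost_one_def lost_two_def algebra_simps)
  have start: "0 \<le> real n * (2 * g)" for n using g by simp
  have one_pos: "0 \<le> t" if "t \<in> phase_one S n" for t n
    using that start[of n] unfolding sets atLeastLessThan_iff by linarith
  have two_pos: "0 \<le> t" if "t \<in> phase_two S n" for t n
    using that start[of n] g unfolding sets atLeastLessThan_iff by linarith
  have "orbit R S k u"
    unfolding orbit_def
  proof (intro conjI allI impI)
    show "continuous_on {0..} u" by (rule cont)
    show "u t \<in> {0..kj R}" "2 * k - u t \<in> {0..kj R}" if "0 \<le> t" for t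
      using region_range[OF R in_i[OF that]] by auto
    show "\<forall>t\<in>phase_one S n. (u has_real_derivative rate_one R k (u t)) (at t within phase_one S n)" for n
      using piece(2)[OF one, of n] rate_one_in_region[OF R ij(1) in_i] one_pos[of _ n] by (simp add: sets)
    show "\<forall>t\<in>phase_two S n. (u has_real_derivative rate_two R k (u t)) (at t within phase_two S n)" for n
      using piece(2)[OF two, of n] rate_two_in_region[OF R ij(2) in_j] two_pos[of _ n] by (simp add: sets)
  qed (simp_all add: sets)
  moreover have u0: "u (real 0 * cyc S) = x" using one[of 0 0] g by simp
  ultimately have "x \<in> combination R S k i j"
    unfolding combination_def using ij in_i one_pos in_j two_pos by blast
  moreover have "poincare R S k x = x"
    using poincare_orbit[OF R S(1) \<open>orbit R S k u\<close>, of 0] one[of 0 1] u0 S g by simp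
  ultimately show ?thesis
    unfolding can_have_stationary_def stationary_def using S(1) by blast
qed

text \<open>With both rings below the critical density the system is symmetric, and in the stationary state the
rings exchange their densities \<open>x\<close> and \<open>x * e\<close> during each phase.\<close>

lemma can_have_stationary_1_5:
  assumes R: "valid_road R" shows "can_have_stationary R 1 5"
proof -
  note v = valid_roadD[OF R]
  define m where "m = (1 - xi R) * (kj R - kc R)"
  have m: "0 < m" "m < kj R - kc R" using v by (auto simp: m_def)
  note reg = region_iff[OF R, folded m_def]
  define e where "e = exp (- gamma1 R)"
  have e: "0 < e" "e < 1" using gamma_pos[OF R] by (auto simp: e_def)
  define x where "x = kc R / 2"
  define k where "k = (x + x * e) / 2"
  have x: "0 < x" "x < kc R" "0 < x * e" "x * e < x" using e v by (auto simp: x_def)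
  have k: "2 * k - x = x * e" "2 * k - x * e = x" unfolding k_def by (simp_all add: field_simps)
  have free: "m * z \<le> kc R * (kj R - z')" if "z < kc R" "z' < kc R" for z z'
  proof -
    have "m * z \<le> m * kc R" using that m by simp
    also have "\<dots> \<le> kc R * (kj R - z')" using that m v by (simp add: mult.commute)
    finally show ?thesis .
  qed
  show ?thesis
  proof (rule can_have_stationaryI[OF R, of 1 5 1 k x "x * e"])
    show "region_flow R k 1 1 x = x * e" by (simp only: region_flow_closed_form[OF R] e_def mult_1_right)
    have "2 * k = x + x * e" using k by linarith
    then have "2 * k + (x * e - 2 * k) * e = x" by (simp add: algebra_simps)
    then show "region_flow R k 5 1 (x * e) = x"
      by (simp only: region_flow_closed_form[OF R] e_def[symmetric] mult_1_right)
  qed (use x e v free in \<open>simp_all add: reg(1,5) k del: One_nat_def\<close>)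
qed

text \<open>Both phases run at capacity and undo each other. The green time \<open>g\<close> is the one that shifts the density
from \<open>x\<close> to \<open>y\<close>. The densities \<open>x\<close> and \<open>y\<close>, which the rings exchange, are placed in the common part of the intervals
allowed by the two regions; \<open>d\<close> is the length of this part.\<close>

lemma can_have_stationary_2_6:
  assumes R: "valid_road R" shows "can_have_stationary R 2 6"
proof -
  note v = valid_roadD[OF R]
  define m where "m = (1 - xi R) * (kj R - kc R)"
  define n where "n = xi R * (kj R - kc R)"
  have mn: "0 < m" "0 < n" "m + n = kj R - kc R" using v by (simp_all add: m_def n_def) (simp_all add: algebra_simps)
  note reg = region_iff[OF R, folded m_def n_def]
  define d where "d = min m n"
  have d: "0 < d" "d \<le> m" "d \<le> n" using mn by (auto simp: d_def)
  define x y where "x = kc R + 3 * d / 4" and "y = kc R + d / 4"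
  define k where "k = (x + y) / 2"
  define g where "g = (x - y) / (gamma1 R * kc R)"
  have g: "0 < g" "gamma1 R * kc R * g = x - y"
    using gamma_pos[OF R] v d by (auto simp: g_def x_def y_def)
  have k: "2 * k - x = y" "2 * k - y = x" unfolding k_def by (simp_all add: field_simps)
  have z: "kc R < z \<and> n < kj R - z \<and> m < kj R - z" if "z = x \<or> z = y" for z
    using that d mn by (auto simp: x_def y_def)
  show ?thesis
  proof (rule can_have_stationaryI[OF R _ _ g(1), of 2 6 k x y])
    show "region_flow R k 2 g x = y" "region_flow R k 6 g y = x"
      using g(2) by (simp_all add: region_flow_closed_form[OF R])
    show "y \<le> x" using d by (simp add: x_def y_def)
  qed (use z[of x] z[of y] v in \<open>simp_all add: reg k\<close>)
qed

text \<open>Ring 2 is jammed and admits no flow, so the state is constant. In the next lemma the same holds with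
ring 1 jammed.\<close>

lemma can_have_stationary_4_7:
  assumes R: "valid_road R" shows "can_have_stationary R 4 7"
proof -
  note v = valid_roadD[OF R]
  have "0 < (1 - xi R) * (kj R - kc R)" "0 < xi R * (kj R - kc R)" using v by simp_all
  then show ?thesis
    using v by (intro can_have_stationaryI[OF R, of 4 7 1 "3 * kj R / 4" "kj R / 2" "kj R / 2"])
      (simp_all add: region_iff[OF R] region_flow_closed_form[OF R])
qed

lemma can_have_stationary_3_8:
  assumes R: "valid_road R" shows "can_have_stationary R 3 8"
proof -
  note v = valid_roadD[OF R]
  have "0 < (1 - xi R) * (kj R - kc R)" "0 < xi R * (kj R - kc R)" using v by simp_all
  then show ?thesis
    using v by (intro can_have_stationaryI[OF R, of 3 8 1 "3 * kj R / 4" "kj R" "kj R"])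
      (simp_all add: region_iff[OF R] region_flow_closed_form[OF R])
qed

text \<open>The vacancies of both rings alternate between \<open>p\<close> and \<open>p * e\<close>, in opposite phase. Membership requires
the ratio \<open>e\<close> to stay below \<open>xi R / (1 - xi R)\<close>, which exceeds 1; its square root is chosen.\<close>

lemma can_have_stationary_3_7:
  assumes R: "valid_road R" and xi: "1 / 2 < xi R" shows "can_have_stationary R 3 7"
proof -
  note v = valid_roadD[OF R]
  define m where "m = (1 - xi R) * (kj R - kc R)"
  define n where "n = xi R * (kj R - kc R)"
  have mn: "0 < m" "0 < n" "m + n = kj R - kc R" using v by (simp_all add: m_def n_def) (simp_all add: algebra_simps)
  note reg = region_iff[OF R, folded m_def n_def]
  define b where "b = ln (xi R / (1 - xi R)) / 2"
  have b: "0 < b" using xi v by (simp add: b_def)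
  define e where "e = exp b"
  have "exp b < exp (2 * b)" using b by simp
  also have "exp (2 * b) = xi R / (1 - xi R)" using v by (simp add: b_def)
  finally have e: "1 < e" "(1 - xi R) * e < xi R" using b v by (simp_all add: e_def field_simps)
  define p where "p = m / 2"
  have p: "0 < p" "p < p * e" using mn e by (simp_all add: p_def)
  have "(1 - xi R) * e * (kj R - kc R) < xi R * (kj R - kc R)" using e(2) v by simp
  then have pe: "2 * (p * e) < n" by (simp add: p_def m_def n_def mult_ac)
  have "(1 - xi R) * e * p < xi R * p" using e(2) p by simp
  then have ratio: "(1 - xi R) * (p * e) < xi R * p" by (simp add: mult_ac)
  moreover have "(1 - xi R) * p < (1 - xi R) * (p * e)" "xi R * p < xi R * (p * e)"
    using p v by simp_all
  ultimately have ratio': "(1 - xi R) * p < xi R * (p * e)" by linarith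
  define r where "r = p * e"
  note p = p[folded r_def] and ratio = ratio[folded r_def] ratio'[folded r_def]
  define k where "k = (2 * kj R - p - r) / 2"
  have k: "2 * k - (kj R - p) = kj R - r" "2 * k - (kj R - r) = kj R - p" "2 * k - kj R = kj R - p - r"
    unfolding k_def by (simp_all add: field_simps)
  have g: "gamma2 R * (b / gamma2 R) = b" "0 < b / gamma2 R" using gamma_pos[OF R] b by simp_all
  show ?thesis
  proof (rule can_have_stationaryI[OF R _ _ g(2), of 3 7 k "kj R - p" "kj R - r"])
    show "region_flow R k 3 (b / gamma2 R) (kj R - p) = kj R - r"
      "region_flow R k 7 (b / gamma2 R) (kj R - r) = kj R - p"
      unfolding region_flow_closed_form[OF R] g(1) e_def[symmetric] k(3) by (simp_all add: r_def algebra_simps)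
  qed (use p pe[folded r_def] ratio mn v in \<open>simp_all add: reg k\<close>)
qed

text \<open>As for \<open>(3, 7)\<close>, but now in each phase the vacancy of the receiving ring decays, by a factor \<open>e\<close> that
has to exceed \<open>xi R / (1 - xi R)\<close>; again the square root of this ratio is chosen.\<close>

lemma can_have_stationary_4_8:
  assumes R: "valid_road R" and xi: "xi R < 1 / 2" shows "can_have_stationary R 4 8"
proof -
  note v = valid_roadD[OF R]
  define m where "m = (1 - xi R) * (kj R - kc R)"
  have m: "0 < m" "m < kj R - kc R" using v by (auto simp: m_def)
  note reg = region_iff[OF R, folded m_def]
  define b where "b = ln ((1 - xi R) / xi R) / 2"
  have b: "0 < b" using xi v by (simp add: b_def)
  define e where "e = exp (- b)"
  have "exp (- (2 * b)) = inverse ((1 - xi R) / xi R)"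
    using v by (simp add: b_def exp_minus)
  then have "xi R / (1 - xi R) = exp (- (2 * b))" by simp
  also have "\<dots> < e" unfolding e_def using b by simp
  finally have "xi R < e * (1 - xi R)" using v by (simp add: pos_divide_less_eq)
  then have e: "0 < e" "e < 1" "xi R < (1 - xi R) * e"
    using b by (simp_all add: e_def mult.commute)
  define p where "p = m / 2"
  have p: "0 < p" "p < m" "0 < p * e" "p * e < p" using m e by (simp_all add: p_def)
  have "xi R * p < (1 - xi R) * e * p" using e(3) p by simp
  then have ratio: "xi R * p < (1 - xi R) * (p * e)" by (simp add: mult_ac)
  moreover have "xi R * (p * e) < xi R * p" "(1 - xi R) * (p * e) < (1 - xi R) * p"
    using p v by simp_all
  ultimately have ratio': "xi R * (p * e) < (1 - xi R) * p" by linarith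
  have dem: "kc R * r < m * (kj R - s)" if "r \<le> p" "s \<le> p" for r s
  proof -
    have "kc R * r \<le> kc R * m" using that p v by simp
    also have "\<dots> < m * (kj R - s)" using that p m by (simp add: mult.commute)
    finally show ?thesis .
  qed
  define r where "r = p * e"
  note p = p[folded r_def] and ratio = ratio[folded r_def] ratio'[folded r_def]
  define k where "k = (2 * kj R - p - r) / 2"
  have k: "2 * k - (kj R - r) = kj R - p" "2 * k - (kj R - p) = kj R - r" "2 * k - kj R = kj R - p - r"
    unfolding k_def by (simp_all add: field_simps)
  have g: "gamma3 R * (b / gamma3 R) = b" "0 < b / gamma3 R" using gamma_pos[OF R] b by simp_all
  show ?thesis
  proof (rule can_have_stationaryI[OF R _ _ g(2), of 4 8 k "kj R - r" "kj R - p"])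
    show "region_flow R k 4 (b / gamma3 R) (kj R - r) = kj R - p"
      "region_flow R k 8 (b / gamma3 R) (kj R - p) = kj R - r"
      unfolding region_flow_closed_form[OF R] g(1) e_def[symmetric] k(3) by (simp_all add: r_def algebra_simps)
  qed (use p dem ratio m v in \<open>simp_all add: reg k\<close>)
qed

text \<open>For \<open>(1, 7)\<close>: \<open>x\<close> is the density of ring 1 at the beginning of phase one and \<open>p\<close> the vacancy of ring 2
at the beginning of phase two. With \<open>a = gamma1 R * g\<close> and \<open>b = gamma2 R * g\<close>, ring 1 loses \<open>x * (1 - exp (- a))\<close>, and the vacancy grows by
\<open>p * (exp b - 1)\<close>; the equation closes the cycle and the inequalities are the conditions of regions
1 and 7. For \<open>(3, 5)\<close> the same numbers are used with the rings exchanged. In the limit of short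
green times the ratio of \<open>p\<close> to \<open>x\<close> is \<open>a / b = xi R * (kj R - kc R) / kc R\<close>, so that with \<open>xi R > 1 / 2\<close>
the conditions hold with room to spare. The bound \<open>exp t \<le> xi R / (1 - xi R)\<close> quantifies how short
is short enough, and \<open>exp t < 2\<close> matches the choice of \<open>x\<close> as half the critical density.\<close>

lemma demand_supply_balance:
  assumes R: "valid_road R" and xi: "1 / 2 < xi R"
  obtains g x p where "0 < g" "0 < x" "x < kc R" "0 < p"
    "p * (exp (gamma2 R * g) - 1) = x * (1 - exp (- (gamma1 R * g)))"
    "p * exp (gamma2 R * g) < xi R * (kj R - kc R)"
    "(1 - xi R) * (kj R - kc R) * x \<le> kc R * (p * exp (gamma2 R * g))"
    "(1 - xi R) * (kj R - kc R) * (x * exp (- (gamma1 R * g))) \<le> kc R * p"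
proof -
  note v = valid_roadD[OF R] and gam = gamma_pos[OF R]
  define m where "m = (1 - xi R) * (kj R - kc R)"
  define n where "n = xi R * (kj R - kc R)"
  have mn: "0 < m" "0 < n" using v by (auto simp: m_def n_def)
  define t where "t = min (ln 2 / 2) (ln (xi R / (1 - xi R)))"
  have t: "0 < t" using xi v by (simp add: t_def)
  have "exp t \<le> exp (ln 2 / 2)" by (simp add: t_def)
  also have "\<dots> < exp (ln 2)" by (simp only: exp_less_cancel_iff) simp
  finally have t2: "exp t < 2" by simp
  have "exp t \<le> exp (ln (xi R / (1 - xi R)))" by (simp add: t_def)
  also have "\<dots> = xi R / (1 - xi R)" using v by simp
  finally have "(1 - xi R) * exp t \<le> xi R" using v by (simp add: field_simps)
  then have "(1 - xi R) * exp t * (kj R - kc R) \<le> xi R * (kj R - kc R)" using v by simp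
  then have t_mn: "m * exp t \<le> n" by (simp add: m_def n_def mult_ac)
  define g where "g = t / (gamma1 R + gamma2 R)"
  define a b where "a = gamma1 R * g" and "b = gamma2 R * g"
  have g: "0 < g" using t gam by (simp add: g_def)
  have "a + b = (gamma1 R + gamma2 R) * g" by (simp add: a_def b_def distrib_right)
  then have "a + b = t" using gam by (simp add: g_def)
  moreover have ab: "0 < a" "0 < b" using g gam by (simp_all add: a_def b_def)
  ultimately have "a \<le> t" "b \<le> t" by simp_all
  then have ea: "exp a \<le> exp t" and eb: "exp b \<le> exp t" by simp_all
  have rel: "kc R * a = n * b"
    unfolding a_def b_def gamma_ratios[OF R] n_def using v by (simp add: field_simps)
  define x where "x = kc R / 2"
  have x: "0 < x" "x < kc R" using v by (simp_all add: x_def)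
  define p where "p = x * (1 - exp (- a)) / (exp b - 1)"
  have p_eq: "p * (exp b - 1) = x * (1 - exp (- a))" and p: "0 < p"
    using ab x by (simp_all add: p_def)
  have ex: "s \<le> exp s - 1" "1 - exp (- s) \<le> s" for s :: real
    using exp_ge_add_one_self[of s] exp_ge_add_one_self[of "- s"] by linarith+
  have "p * b \<le> p * (exp b - 1)" using p by (intro mult_left_mono ex) simp
  also have "\<dots> \<le> x * a" unfolding p_eq using x by (intro mult_left_mono ex) simp
  also have "\<dots> = n / 2 * b" using rel by (simp add: x_def)
  finally have "p \<le> n / 2" using ab by simp
  then have "p * exp b \<le> n / 2 * exp b" by simp
  also have "\<dots> < n / 2 * 2" by (rule mult_strict_left_mono) (use order.strict_trans1[OF eb t2] mn in simp_all)
  finally have p_n: "p * exp b < n" by simp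
  have "x * exp (- a) * a \<le> x * exp (- a) * (exp a - 1)"
    using x by (intro mult_left_mono ex) simp
  also have "\<dots> = x * (1 - exp (- a))" by (simp add: algebra_simps flip: exp_add)
  also have "\<dots> = p * (exp b - 1)" using p_eq by simp
  also have "\<dots> = p * exp b * (1 - exp (- b))" by (simp add: algebra_simps flip: exp_add)
  also have "\<dots> \<le> p * exp b * b"
    using p by (intro mult_left_mono ex) simp
  finally have "kc R * (x * exp (- a) * a) \<le> kc R * (p * exp b * b)" using v by simp
  moreover have "kc R * (x * exp (- a) * a) = x * exp (- a) * n * b"
    using rel by (metis mult.assoc mult.left_commute)
  ultimately have "x * exp (- a) * n * b \<le> kc R * (p * exp b * b)" by linarith
  then have "x * exp (- a) * n * b \<le> kc R * (p * exp b) * b" by (simp only: mult.assoc)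
  then have low: "x * exp (- a) * n \<le> kc R * (p * exp b)" using ab by simp
  have "x * exp (- a) * (m * exp a) \<le> x * exp (- a) * n"
    using t_mn ea mn x by (intro mult_left_mono order_trans[OF mult_left_mono[OF ea]]) auto
  moreover have "x * exp (- a) * (m * exp a) = m * x" by (simp flip: exp_add)
  ultimately have m_x: "m * x \<le> kc R * (p * exp b)" using low by simp
  have "x * exp (- a) * (m * exp b) \<le> x * exp (- a) * n"
    using t_mn eb mn x by (intro mult_left_mono order_trans[OF mult_left_mono[OF eb]]) auto
  then have "x * exp (- a) * (m * exp b) \<le> kc R * (p * exp b)" using low by linarith
  then have "m * (x * exp (- a)) * exp b \<le> kc R * p * exp b" by (simp only: mult_ac)
  then have "m * (x * exp (- a)) \<le> kc R * p" by simp
  from that[OF g x p p_eq[unfolded a_def b_def] p_n[unfolded n_def b_def]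
      m_x[unfolded m_def b_def] this[unfolded m_def a_def]]
  show thesis .
qed

lemma can_have_stationary_1_7:
  assumes R: "valid_road R" and xi: "1 / 2 < xi R" shows "can_have_stationary R 1 7"
proof -
  note v = valid_roadD[OF R]
  define m where "m = (1 - xi R) * (kj R - kc R)"
  define n where "n = xi R * (kj R - kc R)"
  have n: "0 < n" "n < kj R - kc R" using v by (auto simp: n_def)
  note reg = region_iff[OF R, folded m_def n_def]
  obtain g x p where g: "0 < g" and x: "0 < x" "x < kc R" and p: "0 < p"
    and eq: "p * (exp (gamma2 R * g) - 1) = x * (1 - exp (- (gamma1 R * g)))"
    and p_n: "p * exp (gamma2 R * g) < n"
    and m_x: "m * x \<le> kc R * (p * exp (gamma2 R * g))" "m * (x * exp (- (gamma1 R * g))) \<le> kc R * p"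
    using demand_supply_balance[OF R xi] unfolding m_def n_def by metis
  define y r where "y = x * exp (- (gamma1 R * g))" and "r = p * exp (gamma2 R * g)"
  have y: "0 < y" "y < x" using x g gamma_pos[OF R] by (simp_all add: y_def)
  have r: "p < r" using p g gamma_pos[OF R] by (simp add: r_def)
  have bal: "r - p = x - y" using eq by (simp add: y_def r_def algebra_simps)
  define k where "k = (kj R - p + y) / 2"
  have k: "kj R - (2 * k - y) = p" "kj R - (2 * k - x) = r" "2 * k - y = kj R - p" "2 * k - x = kj R - r"
    "2 * k - kj R = y - p"
    using bal unfolding k_def by (simp_all add: field_simps)
  have sup: "(1 - xi R) * s < xi R * (kj R - z)" if "0 \<le> s" "s < n" "z < kc R" for s z
  proof -
    have "(1 - xi R) * s \<le> s" using that v by (simp add: mult_left_le_one_le)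
    also have "s < xi R * (kj R - kc R)" using that by (simp add: n_def)
    also have "\<dots> \<le> xi R * (kj R - z)" using that v by simp
    finally show ?thesis .
  qed
  show ?thesis
  proof (rule can_have_stationaryI[OF R _ _ g, of 1 7 k x y])
    show "region_flow R k 1 g x = y" by (simp only: region_flow_closed_form[OF R] y_def)
    have "y - p + p * exp (gamma2 R * g) = x" using bal by (simp add: r_def)
    then show "region_flow R k 7 g y = x" by (simp only: region_flow_closed_form[OF R] k(5)) simp
    show "(x, k) \<in> region R 1" "(y, k) \<in> region R 1"
      unfolding reg k using x y r p p_n m_x n v by (simp_all flip: y_def r_def)
    show "(x, k) \<in> region R 7" "(y, k) \<in> region R 7"
      unfolding reg k using x y r p p_n n v sup by (simp_all flip: r_def)
  qed (use y in simp_all)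
qed

lemma can_have_stationary_3_5:
  assumes R: "valid_road R" and xi: "1 / 2 < xi R" shows "can_have_stationary R 3 5"
proof -
  note v = valid_roadD[OF R]
  define m where "m = (1 - xi R) * (kj R - kc R)"
  define n where "n = xi R * (kj R - kc R)"
  have n: "0 < n" "n < kj R - kc R" using v by (auto simp: n_def)
  note reg = region_iff[OF R, folded m_def n_def]
  obtain g q p where g: "0 < g" and q: "0 < q" "q < kc R" and p: "0 < p"
    and eq: "p * (exp (gamma2 R * g) - 1) = q * (1 - exp (- (gamma1 R * g)))"
    and p_n: "p * exp (gamma2 R * g) < n"
    and m_q: "m * q \<le> kc R * (p * exp (gamma2 R * g))" "m * (q * exp (- (gamma1 R * g))) \<le> kc R * p"
    using demand_supply_balance[OF R xi] unfolding m_def n_def by metis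
  define l r where "l = q * exp (- (gamma1 R * g))" and "r = p * exp (gamma2 R * g)"
  have l: "0 < l" "l < q" using q g gamma_pos[OF R] by (simp_all add: l_def)
  have r: "p < r" using p g gamma_pos[OF R] by (simp add: r_def)
  have bal: "r - p = q - l" using eq by (simp add: l_def r_def algebra_simps)
  define k where "k = (kj R - r + q) / 2"
  have k: "2 * k - (kj R - r) = q" "2 * k - (kj R - p) = l" "2 * k = kj R - r + q"
    using bal unfolding k_def by (simp_all add: field_simps)
  have sup: "(1 - xi R) * s \<le> xi R * (kj R - z)" if "0 \<le> s" "s < n" "z < kc R" for s z
  proof -
    have "(1 - xi R) * s \<le> s" using that v by (simp add: mult_left_le_one_le)
    also have "s \<le> xi R * (kj R - kc R)" using that by (simp add: n_def)
    also have "\<dots> \<le> xi R * (kj R - z)" using that v by simp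
    finally show ?thesis .
  qed
  show ?thesis
  proof (rule can_have_stationaryI[OF R _ _ g, of 3 5 k "kj R - p" "kj R - r"])
    show "region_flow R k 3 g (kj R - p) = kj R - r"
      by (simp add: region_flow_closed_form[OF R] r_def)
    have "2 * k + (kj R - r - 2 * k) * exp (- (gamma1 R * g)) = 2 * k - l"
      unfolding k(3) by (simp add: l_def)
    then show "region_flow R k 5 g (kj R - r) = kj R - p"
      using k(2) by (simp only: region_flow_closed_form[OF R])
    show "(kj R - p, k) \<in> region R 3" "(kj R - r, k) \<in> region R 3"
      unfolding reg k(1,2) using l q r p p_n n v sup by (simp_all flip: r_def)
    show "(kj R - p, k) \<in> region R 5" "(kj R - r, k) \<in> region R 5"
      unfolding reg k(1,2) using l q r p p_n m_q n v by (simp_all flip: r_def l_def)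
  qed (use r in simp_all)
qed

section \<open>Classification\<close>

theorem theorem4p2:
  fixes R :: road and S :: signal and k :: real
  assumes "valid_road R" and "valid_signal S"
  shows
    "(\<forall>u n. orbit R S k u \<longrightarrow>
       u ((real n + 1) * cyc S) = poincare R S k (u (real n * cyc S))) \<and>
     (1 / 2 < xi R \<longrightarrow>
       (\<forall>i j. can_have_stationary R i j \<longleftrightarrow>
          (i, j) \<in> {(1, 5), (1, 7), (2, 6), (4, 7), (3, 5), (3, 7), (3, 8)})) \<and>
     (xi R < 1 / 2 \<longrightarrow>
       (\<forall>(i, j) \<in> {(1, 5), (2, 6), (4, 7), (4, 8), (3, 8)}. can_have_stationary R i j) \<and>
       (\<forall>i j. \<forall>x \<in> stationary R S k i j.
          (i, j) \<in> {(1, 5), (2, 6), (4, 7), (4, 8), (3, 8)} \<or>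
          (i, j) = (3, 5) \<and> x = kj R \<and> k = kj R / 2)) \<and>
     (xi R = 1 / 2 \<longrightarrow>
       (\<forall>(i, j) \<in> {(1, 5), (2, 6), (4, 7), (3, 8)}. can_have_stationary R i j) \<and>
       (\<forall>i j. \<forall>x \<in> stationary R S k i j.
          (i, j) \<in> {(1, 5), (2, 6), (4, 7), (3, 8)} \<or>
          (i, j) = (3, 5) \<and> x = kj R \<and> k = kj R / 2 \<or>
          (i, j) \<in> {(1, 7), (3, 5)} \<and> kj R = 3 * kc R \<and> k = kj R / 2)) \<and>
     (1 / 2 < xi R \<longrightarrow>
       (let F = (\<lambda>x. 2 * k * (1 - exp (- gamma1 R * green_time S))
                   + x * exp (- 2 * gamma1 R * green_time S))
        in has_map R S k 1 5 F \<and>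
           has_fixed_points R S k 1 5 F {2 * k / (1 + exp (- gamma1 R * green_time S))}) \<and>
       (let F = (\<lambda>x. (kj R - 2 * k) * (exp (gamma5 R * green_time S) - 1)
                   + x * exp ((gamma5 R - gamma1 R) * green_time S))
        in has_map R S k 1 7 F \<and>
           (gamma5 R \<noteq> gamma1 R \<longrightarrow>
            has_fixed_points R S k 1 7 F
              {(kj R - 2 * k) * (exp (gamma5 R * green_time S) - 1)
                 / (1 - exp ((gamma5 R - gamma1 R) * green_time S))})) \<and>
       (let F = (\<lambda>x. x)
        in has_map R S k 2 6 F \<and> has_fixed_points R S k 2 6 F UNIV) \<and>
       (let F = (\<lambda>x. (kj R - 2 * k) * (exp ((gamma5 R - gamma3 R) * green_time S) - 1)
                   + x * exp ((gamma5 R - gamma3 R) * green_time S))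
        in has_map R S k 4 7 F \<and> has_fixed_points R S k 4 7 F {2 * k - kj R}) \<and>
       (let F = (\<lambda>x. kj R * (1 - exp (gamma2 R * green_time S)) * exp (- gamma4 R * green_time S)
                   + 2 * k * (1 - exp (- gamma4 R * green_time S))
                   + x * exp ((gamma2 R - gamma4 R) * green_time S))
        in has_map R S k 3 5 F \<and>
           (gamma2 R \<noteq> gamma4 R \<longrightarrow>
            has_fixed_points R S k 3 5 F
              {(2 * k * (1 - exp (- gamma4 R * green_time S))
                  - kj R * (exp (gamma2 R * green_time S) - 1) * exp (- gamma4 R * green_time S))
                 / (1 - exp ((gamma2 R - gamma4 R) * green_time S))})) \<and>
       (let F = (\<lambda>x. kj R * (2 * exp (gamma2 R * green_time S)
                             - exp (2 * gamma2 R * green_time S) - 1)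
                   - 2 * k * (exp (gamma2 R * green_time S) - 1)
                   + x * exp (2 * gamma2 R * green_time S))
        in has_map R S k 3 7 F \<and>
           has_fixed_points R S k 3 7 F
             {(2 * k + kj R * (exp (gamma2 R * green_time S) - 1))
                / (exp (gamma2 R * green_time S) + 1)}) \<and>
       (let F = (\<lambda>x. kj R * (1 - exp ((gamma2 R - gamma3 R) * green_time S))
                   + x * exp ((gamma2 R - gamma3 R) * green_time S))
        in has_map R S k 3 8 F \<and> has_fixed_points R S k 3 8 F {kj R})) \<and>
     (xi R < 1 / 2 \<longrightarrow>
       (let F = (\<lambda>x. 2 * k * (1 - exp (- gamma1 R * green_time S))
                   + x * exp (- 2 * gamma1 R * green_time S))
        in has_map R S k 1 5 F \<and>
           has_fixed_points R S k 1 5 F {2 * k / (1 + exp (- gamma1 R * green_time S))}) \<and>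
       (let F = (\<lambda>x. x)
        in has_map R S k 2 6 F \<and> has_fixed_points R S k 2 6 F UNIV) \<and>
       (let F = (\<lambda>x. (kj R - 2 * k) * (exp ((gamma5 R - gamma3 R) * green_time S) - 1)
                   + x * exp ((gamma5 R - gamma3 R) * green_time S))
        in has_map R S k 4 7 F \<and> has_fixed_points R S k 4 7 F {2 * k - kj R}) \<and>
       (let F = (\<lambda>x. kj R * (exp (- 2 * gamma3 R * green_time S)
                             - 2 * exp (- gamma3 R * green_time S) + 1)
                   - 2 * k * (exp (- 2 * gamma3 R * green_time S)
                              - exp (- gamma3 R * green_time S))
                   + x * exp (- 2 * gamma3 R * green_time S))
        in has_map R S k 4 8 F \<and>
           has_fixed_points R S k 4 8 F
             {(kj R * (1 - exp (- gamma3 R * green_time S))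
                 + 2 * k * exp (- gamma3 R * green_time S))
                / (1 + exp (- gamma3 R * green_time S))}) \<and>
       (let F = (\<lambda>x. kj R * (1 - exp ((gamma2 R - gamma3 R) * green_time S))
                   + x * exp ((gamma2 R - gamma3 R) * green_time S))
        in has_map R S k 3 8 F \<and> has_fixed_points R S k 3 8 F {kj R})) \<and>
     (xi R = 1 / 2 \<longrightarrow>
       (let F = (\<lambda>x. 2 * k * (1 - exp (- gamma1 R * green_time S))
                   + x * exp (- 2 * gamma1 R * green_time S))
        in has_map R S k 1 5 F \<and>
           has_fixed_points R S k 1 5 F {2 * k / (1 + exp (- gamma1 R * green_time S))}) \<and>
       (\<forall>(i, j) \<in> {(2, 6), (4, 7), (3, 8)}.
          has_map R S k i j (\<lambda>x. x) \<and> has_fixed_points R S k i j (\<lambda>x. x) UNIV))"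
proof -
  note R = assms(1) and S = assms(2)
  have ne: "gamma2 R \<noteq> gamma3 R" "gamma5 R \<noteq> gamma3 R" if "xi R \<noteq> 1 / 2"
    using that gamma2_eq_gamma3_iff[OF R] by (simp_all add: gamma5_def)
  note exist = can_have_stationary_1_5[OF R] can_have_stationary_2_6[OF R]
    can_have_stationary_4_7[OF R] can_have_stationary_3_8[OF R]
  note exist_large = can_have_stationary_1_7[OF R] can_have_stationary_3_5[OF R]
    can_have_stationary_3_7[OF R]
  note maps = map_1_5[OF R S] map_1_7[OF R S] map_2_6[OF R S] map_4_7[OF R S] map_3_5[OF R S]
    map_3_7[OF R S] map_3_8[OF R S] map_4_8[OF R S]
  show ?thesis
    unfolding Let_def
  proof (intro conjI impI)
    show "\<forall>u n. orbit R S k u \<longrightarrow>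
       u ((real n + 1) * cyc S) = poincare R S k (u (real n * cyc S))"
      using poincare_orbit[OF R S] by simp
    show "\<forall>i j. can_have_stationary R i j \<longleftrightarrow>
          (i, j) \<in> {(1, 5), (1, 7), (2, 6), (4, 7), (3, 5), (3, 7), (3, 8)}" if xi: "1 / 2 < xi R"
    proof (intro allI iffI)
      fix i j assume "can_have_stationary R i j"
      then obtain S' k' x where "valid_signal S'" "x \<in> stationary R S' k' i j"
        unfolding can_have_stationary_def by blast
      from stationary_cases[OF R this]
      show "(i, j) \<in> {(1, 5), (1, 7), (2, 6), (4, 7), (3, 5), (3, 7), (3, 8)}"
        using xi by auto
    next
      fix i j :: nat assume "(i, j) \<in> {(1, 5), (1, 7), (2, 6), (4, 7), (3, 5), (3, 7), (3, 8)}"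
      then show "can_have_stationary R i j" using exist exist_large[OF xi] by blast
    qed
    show "\<forall>(i, j) \<in> {(1, 5), (2, 6), (4, 7), (4, 8), (3, 8)}. can_have_stationary R i j"
      if "xi R < 1 / 2"
      using exist can_have_stationary_4_8[OF R that] by blast
    show "\<forall>(i, j) \<in> {(1, 5), (2, 6), (4, 7), (3, 8)}. can_have_stationary R i j"
      using exist by blast
    show "\<forall>i j. \<forall>x \<in> stationary R S k i j.
          (i, j) \<in> {(1, 5), (2, 6), (4, 7), (4, 8), (3, 8)} \<or>
          (i, j) = (3, 5) \<and> x = kj R \<and> k = kj R / 2" if xi: "xi R < 1 / 2"
    proof (intro allI ballI)
      fix i j x assume "x \<in> stationary R S k i j"
      from stationary_cases[OF R S this] xi
      show "(i, j) \<in> {(1, 5), (2, 6), (4, 7), (4, 8), (3, 8)} \<or>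
          (i, j) = (3, 5) \<and> x = kj R \<and> k = kj R / 2" by auto
    qed
    show "\<forall>i j. \<forall>x \<in> stationary R S k i j.
          (i, j) \<in> {(1, 5), (2, 6), (4, 7), (3, 8)} \<or>
          (i, j) = (3, 5) \<and> x = kj R \<and> k = kj R / 2 \<or>
          (i, j) \<in> {(1, 7), (3, 5)} \<and> kj R = 3 * kc R \<and> k = kj R / 2" if xi: "xi R = 1 / 2"
    proof (intro allI ballI)
      fix i j x assume "x \<in> stationary R S k i j"
      from stationary_cases[OF R S this] xi
      show "(i, j) \<in> {(1, 5), (2, 6), (4, 7), (3, 8)} \<or>
          (i, j) = (3, 5) \<and> x = kj R \<and> k = kj R / 2 \<or>
          (i, j) \<in> {(1, 7), (3, 5)} \<and> kj R = 3 * kc R \<and> k = kj R / 2" by auto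
    qed
    show "\<forall>(i, j) \<in> {(2, 6), (4, 7), (3, 8)}.
          has_map R S k i j (\<lambda>x. x) \<and> has_fixed_points R S k i j (\<lambda>x. x) UNIV" if "xi R = 1 / 2"
    proof -
      have eq: "gamma5 R = gamma3 R" "gamma2 R = gamma3 R"
        using that gamma2_eq_gamma3_iff[OF R] by (simp_all add: gamma5_def)
      have "has_map R S k 4 7 (\<lambda>x. x)" "has_map R S k 3 8 (\<lambda>x. x)"
        using map_4_7(1)[OF R S, of k] map_3_8(1)[OF R S, of k] eq by simp_all
      then show ?thesis using map_2_6[OF R S, of k] has_fixed_pointsI[of R S k _ _ "\<lambda>x. x" UNIV] by auto
    qed
  qed (rule maps; (assumption | rule ne, linarith))+
qed

end
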